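(* Let $\sigma_1,\dots,\sigma_K>0$ be the true volatility values, let $X^n$ be the corresponding observed process, and let $\Pi_n$ be the posterior distribution of $(\xi_1,\dots,\xi_K)$ given $X^n$ (all as defined in the context). Let $(m_n)$ be any sequence of positive real numbers converging to infinity. Then, for every $k=1,\dots,K$, as $n\to\infty$, $$\Pi_n\Bigl(|\xi_k-\sigma_k|>\frac{m_n}{\sqrt n}\Bigr)\to 0\quad\text{in probability},$$ where convergence in probability is with respect to the law of $X^n$.
   Context: Fix $\alpha,\beta>0$. $\mathrm{Gamma}(a,b)$ is the gamma distribution with shape $a$ and rate $b$; $\mathrm{IG}(a,b)$ is the inverse gamma distribution with density $x\mapsto \frac{b^a}{\Gamma(a)}x^{-a-1}e^{-b/x}$, $x>0$. $L=(L_t)_{t\ge0}$ is a gamma process: a Lévy process with $L_0=0$ and $L_t-L_s\sim\mathrm{Gamma}(\alpha(t-s),\beta)$ for $t>s\ge 0$ (Lévy density $\alpha x^{-1}e^{-\beta x}$, $x>0$). Fix $K\ge1$ and levels $0=b_0<b_1<\dots<b_K<\infty$, with bins $B_1=[0,b_1]$, $B_k=(b_{k-1},b_k]$ for $k=2,\dots,K-1$, $B_K=(b_{K-1},b_K)$. Let $\sigma_1,\dots,\sigma_K>0$ be constants. For $n\ge1$ the process $X^n$ is the solution to $$dX^n_t=\frac1n\sum_{k=1}^K\sigma_k\mathbf 1_{B_k}(X^n_{t-})\,dL_t,\qquad X^n_0=0,$$ observed continuously until the time it reaches or surpasses level $b_K$. Put $\tau^n_0=0$, $\tau^n_k=\inf\{t\ge0: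 X^n_t\ge b_k\}$, $\Delta\tau^n_k=\tau^n_k-\tau^n_{k-1}$, $\Delta X^n_{\tau^n_k}=X^n_{\tau^n_k}-X^n_{\tau^n_{k-1}}$ for $k=1,\dots,K$. In the Bayesian model the $\sigma_k$ are modelled as independent random variables $\xi_k$ with priors $\xi_k\sim\mathrm{IG}(\alpha_k,\beta_k)$, where $\alpha_k,\beta_k>0$ are fixed. The posterior $\Pi_n$ given $X^n$ on $[0,\tau^n_K]$ is the (random) distribution under which $\xi_1,\dots,\xi_K$ are independent with $\xi_k\sim\mathrm{IG}(\alpha\Delta\tau^n_k+\alpha_k,\ n\beta\Delta X^n_{\tau^n_k}+\beta_k)$. *)

theory Defs
  imports "HOL-Probability.Probability"
begin

text \<open>Shape \<open>a\<close> and rate \<open>b\<close>.\<close>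

definition gamma_density :: "real \<Rightarrow> real \<Rightarrow> real \<Rightarrow> real" where
  "gamma_density a b x =
     (if 0 < x then b powr a / Gamma a * x powr (a - 1) * exp (- (b * x)) else 0)"

definition inverse_gamma_density :: "real \<Rightarrow> real \<Rightarrow> real \<Rightarrow> real" where
  "inverse_gamma_density a b x =
     (if 0 < x then b powr a / Gamma a * x powr (- a - 1) * exp (- (b / x)) else 0)"

definition inverse_gamma :: "real \<Rightarrow> real \<Rightarrow> real measure" where
  "inverse_gamma a b = density lborel (\<lambda>x. ennreal (inverse_gamma_density a b x))"

text \<open>Processes and paths have time type \<^typ>\<open>real\<close>; only times \<open>t \<ge> 0\<close> are meaningful.\<close>

definition cadlag :: "(real \<Rightarrow> real) \<Rightarrow> bool" where
  "cadlag f \<longleftrightarrow>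
     (\<forall>t\<ge>0. continuous (at_right t) f) \<and> (\<forall>t>0. \<exists>l. (f \<longlongrightarrow> l) (at_left t))"

definition levy_process :: "'a measure \<Rightarrow> (real \<Rightarrow> 'a \<Rightarrow> real) \<Rightarrow> bool" where
  "levy_process M L \<longleftrightarrow>
     (\<forall>t\<ge>0. L t \<in> borel_measurable M) \<and>
     (AE \<omega> in M. L 0 \<omega> = 0) \<and>
     (\<forall>(N::nat) (t::nat \<Rightarrow> real). 0 \<le> t 0 \<longrightarrow> (\<forall>i<N. t i < t (Suc i)) \<longrightarrow>
        prob_space.indep_vars M (\<lambda>_. borel) (\<lambda>i \<omega>. L (t (Suc i)) \<omega> - L (t i) \<omega>) {..<N}) \<and>
     (\<forall>s\<ge>0. \<forall>t>s. distr M borel (\<lambda>\<omega>. L t \<omega> - L s \<omega>) = distr M borel (\<lambda>\<omega>. L (t - s) \<omega> - L 0 \<omega>)) \<and>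
     (AE \<omega> in M. cadlag (\<lambda>t. L t \<omega>))"

definition gamma_process :: "'a measure \<Rightarrow> real \<Rightarrow> real \<Rightarrow> (real \<Rightarrow> 'a \<Rightarrow> real) \<Rightarrow> bool" where
  "gamma_process M \<alpha> \<beta> L \<longleftrightarrow>
     levy_process M L \<and>
     (\<forall>s\<ge>0. \<forall>t>s. distributed M lborel (\<lambda>\<omega>. L t \<omega> - L s \<omega>) (gamma_density (\<alpha> * (t - s)) \<beta>))"

text \<open>The first bin is closed at \<open>b\<^sub>0\<close> and the last one is open at \<open>b\<^sub>K\<close>; for \<open>K = 1\<close> the
  single bin is therefore \<open>[b\<^sub>0, b\<^sub>1)\<close>.\<close>

definition bin :: "(nat \<Rightarrow> real) \<Rightarrow> nat \<Rightarrow> nat \<Rightarrow> real set" where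
  "bin b K k = {x. (if k = 1 then b (k - 1) \<le> x else b (k - 1) < x) \<and>
                   (if k = K then x < b k else x \<le> b k)}"

definition volatility :: "(nat \<Rightarrow> real) \<Rightarrow> nat \<Rightarrow> (nat \<Rightarrow> real) \<Rightarrow> real \<Rightarrow> real" where
  "volatility b K \<sigma> x = (\<Sum>k=1..K. \<sigma> k * indicator (bin b K k) x)"

text \<open>Lebesgue--Stieltjes integral of \<open>g\<close> over \<open>(0, t]\<close> against a right-continuous nondecreasing
  \<open>l\<close> on \<open>[0, \<infinity>)\<close>. Clamping the argument at \<open>0\<close> extends \<open>l\<close> constantly to the left. Almost all
  paths of a gamma process qualify, so a stochastic integral against it is taken pathwise.\<close>

definition stieltjes_integral :: "(real \<Rightarrow> real) \<Rightarrow> real \<Rightarrow> (real \<Rightarrow> real) \<Rightarrow> real" where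
  "stieltjes_integral l t g = (LINT s:{0<..t}|interval_measure (\<lambda>s. l (max 0 s)). g s)"

text \<open>\<open>X\<close> solves \<open>dX\<^sub>t = (1/n) v(X\<^sub>t\<^sub>-) dL\<^sub>t\<close>, \<open>X\<^sub>0 = 0\<close>, with \<open>v\<close> the piecewise constant volatility.\<close>

definition sde_solution ::
  "'a measure \<Rightarrow> (real \<Rightarrow> 'a \<Rightarrow> real) \<Rightarrow> (nat \<Rightarrow> real) \<Rightarrow> nat \<Rightarrow> (nat \<Rightarrow> real) \<Rightarrow> nat \<Rightarrow>
   (real \<Rightarrow> 'a \<Rightarrow> real) \<Rightarrow> bool" where
  "sde_solution M L b K \<sigma> n X \<longleftrightarrow>
     (\<forall>t\<ge>0. X t \<in> borel_measurable M) \<and>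
     (AE \<omega> in M. cadlag (\<lambda>t. X t \<omega>)) \<and>
     (AE \<omega> in M. X 0 \<omega> = 0 \<and>
        (\<forall>t\<ge>0. X t \<omega> = 1 / real n *
           stieltjes_integral (\<lambda>s. L s \<omega>) t
             (\<lambda>s. volatility b K \<sigma> (Lim (at_left s) (\<lambda>r. X r \<omega>)))))"

text \<open>In the following, \<open>x\<close> is a single path. Almost every path of a solution reaches all
  levels, so the unspecified infimum of the empty set plays no role.\<close>

definition hit_time :: "(nat \<Rightarrow> real) \<Rightarrow> (real \<Rightarrow> real) \<Rightarrow> nat \<Rightarrow> real" where
  "hit_time b x k = (if k = 0 then 0 else Inf {t. 0 \<le> t \<and> b k \<le> x t})"

definition delta_time :: "(nat \<Rightarrow> real) \<Rightarrow> (real \<Rightarrow> real) \<Rightarrow> nat \<Rightarrow> real" where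
  "delta_time b x k = hit_time b x k - hit_time b x (k - 1)"

definition delta_path :: "(nat \<Rightarrow> real) \<Rightarrow> (real \<Rightarrow> real) \<Rightarrow> nat \<Rightarrow> real" where
  "delta_path b x k = x (hit_time b x k) - x (hit_time b x (k - 1))"

text \<open>Posterior law of \<open>(\<xi>\<^sub>1, \<dots>, \<xi>\<^sub>K)\<close> given the path \<open>x\<close>, for independent inverse gamma priors
  with shapes \<open>pa k\<close> and scales \<open>pb k\<close>.\<close>

definition posterior ::
  "real \<Rightarrow> real \<Rightarrow> (nat \<Rightarrow> real) \<Rightarrow> (nat \<Rightarrow> real) \<Rightarrow> (nat \<Rightarrow> real) \<Rightarrow> nat \<Rightarrow> nat \<Rightarrow> (real \<Rightarrow> real) \<Rightarrow>
   (nat \<Rightarrow> real) measure" where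
  "posterior \<alpha> \<beta> pa pb b K n x =
     (\<Pi>\<^sub>M k\<in>{1..K}. inverse_gamma (\<alpha> * delta_time b x k + pa k)
                                  (real n * \<beta> * delta_path b x k + pb k))"

text \<open>Measurability is part of the notion, because \<^const>\<open>measure\<close> is \<open>0\<close> on nonmeasurable sets;
  finitely many indices are exempt from it.\<close>

definition tendsto_in_prob :: "'a measure \<Rightarrow> (nat \<Rightarrow> 'a \<Rightarrow> real) \<Rightarrow> real \<Rightarrow> bool" where
  "tendsto_in_prob M Y c \<longleftrightarrow>
     (\<forall>\<^sub>F n in sequentially. Y n \<in> borel_measurable M) \<and>
     (\<forall>\<epsilon>>0. (\<lambda>n. measure M {\<omega> \<in> space M. \<bar>Y n \<omega> - c\<bar> > \<epsilon>}) \<longlonglongrightarrow> 0)"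

text \<open>Path properties above hold only almost surely, so functionals of whole paths such as
  \<^const>\<open>hit_time\<close> are random variables on \<^term>\<open>completion M\<close> rather than on \<open>M\<close>.\<close>

end

theory Submission
  imports Defs
begin

text \<open>No maximal inequality is needed. Up to overshoots, \<open>X\<^sup>n\<close> passes the level \<open>b\<^sub>k\<close> when \<open>L\<close>
  passes the deterministic level \<open>n c\<^sub>k\<close>, with \<open>c\<^sub>k = \<Sum>\<^sub>j (b\<^sub>j - b\<^sub>j\<^sub>-\<^sub>1) / \<sigma>\<^sub>j\<close>. Chebyshev's inequality at the
  two deterministic times \<open>n c\<^sub>k \<beta> / \<alpha> \<plusminus> \<rho> \<surd>n\<close> and monotonicity of \<open>L\<close> trap both \<open>\<tau>\<^sub>k\<close> and the overshoot
  there, and induction on \<open>k\<close> gives \<open>\<tau>\<^sub>k = n c\<^sub>k \<beta> / \<alpha> + O\<^sub>P(\<surd>n)\<close> and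
  \<open>n X\<^sup>n(\<tau>\<^sub>k) = n b\<^sub>k + O\<^sub>P(\<surd>n)\<close>. Hence the posterior of \<open>\<xi>\<^sub>k\<close> is an inverse gamma distribution whose shape
  \<open>a\<close> is of order \<open>n\<close> and whose scale is \<open>\<sigma>\<^sub>k (a - 2) + O\<^sub>P(\<surd>n)\<close>, so its second moment about \<open>\<sigma>\<^sub>k\<close> is
  \<open>O\<^sub>P(1 / n)\<close>, and Chebyshev's inequality for the posterior concludes.\<close>

subsection \<open>Gamma and inverse gamma densities\<close>

text \<open>Euler's integral after the substitution \<open>t = g x\<close>. It serves both families:
  \<open>g x = b * x\<close> normalises the gamma density and \<open>g x = b / x\<close> the inverse
  gamma density.\<close>

lemma nn_integral_Gamma_substitution:
  fixes g g' :: "real \<Rightarrow> real"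
  assumes a: "a > 0"
    and g: "\<And>x. x > 0 \<Longrightarrow> (g has_real_derivative g' x) (at x)"
    and bij: "bij_betw g {0<..} {0<..}"
  shows "(\<integral>\<^sup>+x. ennreal (indicator {0<..} x * (\<bar>g' x\<bar> * (g x powr (a - 1) / exp (g x)))) \<partial>lborel) = Gamma a"
proof -
  let ?f = "\<lambda>t::real. t powr (a - 1) / exp t"
  have f: "(?f has_integral Gamma a) {0<..}"
    using Gamma_integral_real[OF a]
    by (subst has_integral_spike_set_eq[where T="{0..}"]) (auto intro: negligible_subset[of "{0}"])
  have img: "g ` {0<..} = {0<..}" and inj: "inj_on g {0<..}"
    using bij by (auto simp: bij_betw_def)
  have "?f absolutely_integrable_on {0<..}"
    using f by (intro nonnegative_absolutely_integrable_1) (auto simp: has_integral_iff)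
  then have "?f absolutely_integrable_on g ` {0<..} \<and> integral (g ` {0<..}) ?f = Gamma a"
    using f by (simp add: img integral_unique)
  moreover have "(g has_real_derivative g' x) (at x within {0<..})" if "x \<in> {0<..}" for x
    using g that by (auto intro: has_field_derivative_at_within)
  ultimately have A: "(\<lambda>x. \<bar>g' x\<bar> * ?f (g x)) absolutely_integrable_on {0<..} \<and>
      integral {0<..} (\<lambda>x. \<bar>g' x\<bar> * ?f (g x)) = Gamma a"
    by (intro has_absolute_integral_change_of_variables_1'[THEN iffD2] inj) simp_all
  have "((\<lambda>x. \<bar>g' x\<bar> * ?f (g x)) has_integral Gamma a) {0<..}"
    using A set_lebesgue_integral_eq_integral(1)[OF conjunct1[OF A]] by (simp add: has_integral_iff)
  from nn_integral_has_integral_lebesgue[OF _ this] show ?thesis by simp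
qed

lemma measurable_gamma_density[measurable]: "gamma_density a b \<in> borel_measurable borel"
  unfolding gamma_density_def by measurable

lemma measurable_inverse_gamma_density[measurable]:
  "inverse_gamma_density a b \<in> borel_measurable borel"
  unfolding inverse_gamma_density_def by measurable

lemma gamma_density_nonneg: "a > 0 \<Longrightarrow> 0 \<le> gamma_density a b x"
  by (auto simp: gamma_density_def intro!: mult_nonneg_nonneg divide_nonneg_pos Gamma_real_pos)

lemma inverse_gamma_density_nonneg: "a > 0 \<Longrightarrow> 0 \<le> inverse_gamma_density a b x"
  by (auto simp: inverse_gamma_density_def intro!: mult_nonneg_nonneg divide_nonneg_pos Gamma_real_pos)

lemma nn_integral_gamma_density:
  assumes "a > 0" "b > 0"
  shows "(\<integral>\<^sup>+x. ennreal (gamma_density a b x) \<partial>lborel) = 1"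
proof -
  have G: "Gamma a > 0" using assms by (intro Gamma_real_pos)
  have bij: "bij_betw ((*) b) {0<..} {0<..}"
    by (rule bij_betw_byWitness[where f'="\<lambda>x. x / b"]) (use assms in auto)
  have "gamma_density a b x =
      1 / Gamma a * (indicator {0<..} x * (\<bar>b\<bar> * ((b * x) powr (a - 1) / exp (b * x))))" for x
    using assms by (auto simp: gamma_density_def powr_mult exp_minus powr_diff field_simps)
  then have "(\<integral>\<^sup>+x. ennreal (gamma_density a b x) \<partial>lborel) =
      (\<integral>\<^sup>+x. ennreal (1 / Gamma a) * ennreal (indicator {0<..} x * (\<bar>b\<bar> * ((b * x) powr (a - 1) / exp (b * x)))) \<partial>lborel)"
    using G by (simp add: ennreal_mult' flip: ennreal_mult')
  also have "\<dots> = ennreal (1 / Gamma a) * Gamma a"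
    by (subst nn_integral_cmult, measurable)
       (subst nn_integral_Gamma_substitution[OF assms(1) _ bij, of "\<lambda>_. b"], auto intro!: derivative_eq_intros)
  also have "\<dots> = 1" using G by (simp flip: ennreal_mult)
  finally show ?thesis .
qed

lemma nn_integral_inverse_gamma_density:
  assumes "a > 0" "b > 0"
  shows "(\<integral>\<^sup>+x. ennreal (inverse_gamma_density a b x) \<partial>lborel) = 1"
proof -
  have G: "Gamma a > 0" using assms by (intro Gamma_real_pos)
  have bij: "bij_betw (\<lambda>x. b / x) {0<..} {0<..}"
    by (rule bij_betw_byWitness[where f'="\<lambda>x. b / x"]) (use assms in auto)
  have "inverse_gamma_density a b x =
      1 / Gamma a * (indicator {0<..} x * (\<bar>- b / x\<^sup>2\<bar> * ((b / x) powr (a - 1) / exp (b / x))))" for x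
    using assms by (auto simp: inverse_gamma_density_def powr_divide exp_minus powr_diff powr_minus
      power2_eq_square field_simps)
  then have "(\<integral>\<^sup>+x. ennreal (inverse_gamma_density a b x) \<partial>lborel) =
      (\<integral>\<^sup>+x. ennreal (1 / Gamma a) * ennreal (indicator {0<..} x * (\<bar>- b / x\<^sup>2\<bar> * ((b / x) powr (a - 1) / exp (b / x)))) \<partial>lborel)"
    using G by (simp add: ennreal_mult' flip: ennreal_mult')
  also have "\<dots> = ennreal (1 / Gamma a) * Gamma a"
    by (subst nn_integral_cmult, measurable)
       (subst nn_integral_Gamma_substitution[OF assms(1) _ bij, of "\<lambda>x. - b / x\<^sup>2"],
        auto intro!: derivative_eq_intros simp: power2_eq_square)
  also have "\<dots> = 1" using G by (simp flip: ennreal_mult)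
  finally show ?thesis .
qed

lemma prob_space_inverse_gamma: "a > 0 \<Longrightarrow> b > 0 \<Longrightarrow> prob_space (inverse_gamma a b)"
  by (rule prob_spaceI) (simp add: inverse_gamma_def emeasure_density nn_integral_inverse_gamma_density)

lemma has_bochner_integral_gamma_density:
  assumes "a > 0" "b > 0"
  shows "has_bochner_integral lborel (gamma_density a b) 1"
  by (rule has_bochner_integral_nn_integral)
     (auto simp: gamma_density_nonneg nn_integral_gamma_density assms)

lemma has_bochner_integral_inverse_gamma_density:
  assumes "a > 0" "b > 0"
  shows "has_bochner_integral lborel (inverse_gamma_density a b) 1"
  by (rule has_bochner_integral_nn_integral)
     (auto simp: inverse_gamma_density_nonneg nn_integral_inverse_gamma_density assms)

text \<open>Size biasing: a factor \<open>x\<close> raises the shape by one, by the functional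
  equation of \<open>Gamma\<close>, so polynomial moments reduce to normalisation.\<close>

lemma gamma_density_shift:
  assumes "a > 0" "b > 0"
  shows "x * gamma_density a b x = a / b * gamma_density (a + 1) b x"
proof -
  have "Gamma a > 0" using assms by (intro Gamma_real_pos)
  moreover have "Gamma (a + 1) = a * Gamma a"
    using assms by (intro Gamma_plus1) (auto elim!: nonpos_Ints_cases)
  ultimately show ?thesis using assms
    by (auto simp: gamma_density_def powr_add powr_diff divide_simps)
qed

text \<open>Here a factor \<open>x\<close> lowers the shape by one, so each moment costs one unit of
  shape and \<open>a > 1\<close> keeps the new shape positive.\<close>

lemma inverse_gamma_density_shift:
  assumes "a > 1" "b > 0"
  shows "x * inverse_gamma_density a b x = b / (a - 1) * inverse_gamma_density (a - 1) b x"
proof -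
  have "Gamma (a - 1) > 0" using assms by (intro Gamma_real_pos) auto
  moreover have "Gamma a = (a - 1) * Gamma (a - 1)"
    using assms Gamma_plus1[of "a - 1"] by (force elim!: nonpos_Ints_cases)
  ultimately show ?thesis using assms
    by (auto simp: inverse_gamma_density_def powr_add powr_diff powr_minus divide_simps)
qed

lemma gamma_second_moment:
  assumes "a > 0" "b > 0"
  shows "has_bochner_integral lborel (\<lambda>x. (x - a / b)\<^sup>2 * gamma_density a b x) (a / b\<^sup>2)"
proof -
  have "(x - a / b)\<^sup>2 * gamma_density a b x =
      a / b * ((a + 1) / b) * gamma_density (a + 2) b x - 2 * (a / b) * (a / b) * gamma_density (a + 1) b x
      + (a / b)\<^sup>2 * gamma_density a b x" for x
  proof -
    have "(x - a / b)\<^sup>2 * gamma_density a b x =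
       x * (x * gamma_density a b x) - 2 * (a / b) * (x * gamma_density a b x) + (a / b)\<^sup>2 * gamma_density a b x"
      by (simp add: power2_eq_square algebra_simps)
    also have "x * (x * gamma_density a b x) = a / b * (x * gamma_density (a + 1) b x)"
      using gamma_density_shift[OF assms, of x] by simp
    also have "x * gamma_density (a + 1) b x = (a + 1) / b * gamma_density (a + 2) b x"
      using gamma_density_shift[of "a + 1" b x] assms by (simp add: add.assoc)
    also have "x * gamma_density a b x = a / b * gamma_density (a + 1) b x"
      by (rule gamma_density_shift[OF assms])
    finally show ?thesis by (simp add: mult.assoc)
  qed
  moreover have "has_bochner_integral lborel (\<lambda>x. a / b * ((a + 1) / b) * gamma_density (a + 2) b x
      - 2 * (a / b) * (a / b) * gamma_density (a + 1) b x + (a / b)\<^sup>2 * gamma_density a b x)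
      (a / b * ((a + 1) / b) * 1 - 2 * (a / b) * (a / b) * 1 + (a / b)\<^sup>2 * 1)"
    using assms by (intro has_bochner_integral_add has_bochner_integral_diff
      has_bochner_integral_mult_right has_bochner_integral_gamma_density) auto
  moreover have "a / b * ((a + 1) / b) * 1 - 2 * (a / b) * (a / b) * 1 + (a / b)\<^sup>2 * 1 = a / b\<^sup>2"
    using assms by (simp add: power2_eq_square field_simps)
  ultimately show ?thesis by simp
qed

text \<open>The centre \<open>c\<close> is arbitrary because the posterior is compared with the true
  volatility rather than with its own mean. The value is arranged to show that only the distance of
  \<open>b\<close> from \<open>c * (a - 2)\<close> matters, up to a term of order
  \<open>1 / a\<close>.\<close>

lemma inverse_gamma_second_moment:
  assumes "a > 2" "b > 0"
  shows "has_bochner_integral lborel (\<lambda>x. (x - c)\<^sup>2 * inverse_gamma_density a b x)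
    (((b - c * (a - 2))\<^sup>2 + c\<^sup>2 * (a - 2)) / ((a - 1) * (a - 2)))"
proof -
  have "(x - c)\<^sup>2 * inverse_gamma_density a b x =
      b / (a - 1) * (b / (a - 2)) * inverse_gamma_density (a - 2) b x
      - 2 * c * (b / (a - 1)) * inverse_gamma_density (a - 1) b x
      + c\<^sup>2 * inverse_gamma_density a b x" for x
  proof -
    have "(x - c)\<^sup>2 * inverse_gamma_density a b x =
       x * (x * inverse_gamma_density a b x) - 2 * c * (x * inverse_gamma_density a b x)
       + c\<^sup>2 * inverse_gamma_density a b x"
      by (simp add: power2_eq_square algebra_simps)
    also have "x * (x * inverse_gamma_density a b x) = b / (a - 1) * (x * inverse_gamma_density (a - 1) b x)"
      using inverse_gamma_density_shift[of a b x] assms by simp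
    also have "x * inverse_gamma_density (a - 1) b x = b / (a - 2) * inverse_gamma_density (a - 2) b x"
      using inverse_gamma_density_shift[of "a - 1" b x] assms by simp
    also have "x * inverse_gamma_density a b x = b / (a - 1) * inverse_gamma_density (a - 1) b x"
      using inverse_gamma_density_shift[of a b x] assms by simp
    finally show ?thesis by (simp add: mult.assoc)
  qed
  moreover have "has_bochner_integral lborel (\<lambda>x. b / (a - 1) * (b / (a - 2)) * inverse_gamma_density (a - 2) b x
      - 2 * c * (b / (a - 1)) * inverse_gamma_density (a - 1) b x
      + c\<^sup>2 * inverse_gamma_density a b x)
      (b / (a - 1) * (b / (a - 2)) * 1 - 2 * c * (b / (a - 1)) * 1 + c\<^sup>2 * 1)"
    using assms by (intro has_bochner_integral_add has_bochner_integral_diff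
      has_bochner_integral_mult_right has_bochner_integral_inverse_gamma_density) auto
  moreover have "b / (a - 1) * (b / (a - 2)) * 1 - 2 * c * (b / (a - 1)) * 1 + c\<^sup>2 * 1 =
      ((b - c * (a - 2))\<^sup>2 + c\<^sup>2 * (a - 2)) / ((a - 1) * (a - 2))"
  proof -
    define d where "d = a - 2"
    have "a - 1 = d + 1" "a - 2 = d" "d > 0" using assms by (auto simp: d_def)
    then show ?thesis
      by (simp add: power2_eq_square divide_simps add_pos_pos) (simp add: algebra_simps)
  qed
  ultimately show ?thesis by simp
qed

text \<open>Where \<open>\<bar>x - c\<bar> > \<epsilon>\<close>, the factor
  \<open>(x - c)\<^sup>2 / \<epsilon>\<^sup>2\<close> is at least one. The bound serves gamma
  increments about their mean and posteriors about the true value.\<close>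

lemma measure_density_Chebyshev:
  fixes f :: "real \<Rightarrow> real"
  assumes [measurable]: "f \<in> borel_measurable borel"
    and nn: "\<And>x. 0 \<le> f x" and V: "has_bochner_integral lborel (\<lambda>x. (x - c)\<^sup>2 * f x) V" and "\<epsilon> > 0"
  shows "measure (density lborel (\<lambda>x. ennreal (f x))) {x. \<bar>x - c\<bar> > \<epsilon>} \<le> V / \<epsilon>\<^sup>2"
proof -
  have V0: "0 \<le> V"
    unfolding has_bochner_integral_integral_eq[OF V, symmetric]
    by (intro Bochner_Integration.integral_nonneg) (simp add: nn)
  have "emeasure (density lborel (\<lambda>x. ennreal (f x))) {x. \<bar>x - c\<bar> > \<epsilon>} =
      (\<integral>\<^sup>+x. ennreal (f x) * indicator {x. \<bar>x - c\<bar> > \<epsilon>} x \<partial>lborel)"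
    by (subst emeasure_density) auto
  also have "\<dots> \<le> (\<integral>\<^sup>+x. ennreal (1 / \<epsilon>\<^sup>2 * ((x - c)\<^sup>2 * f x)) \<partial>lborel)"
  proof (intro nn_integral_mono)
    fix x
    have "f x \<le> 1 / \<epsilon>\<^sup>2 * ((x - c)\<^sup>2 * f x)" if "\<bar>x - c\<bar> > \<epsilon>"
    proof -
      have "1 \<le> (x - c)\<^sup>2 / \<epsilon>\<^sup>2"
        using that \<open>\<epsilon> > 0\<close> abs_le_square_iff[of \<epsilon> "x - c"] by (simp add: divide_simps)
      from mult_right_mono[OF this nn[of x]] show ?thesis by simp
    qed
    then show "ennreal (f x) * indicator {x. \<bar>x - c\<bar> > \<epsilon>} x \<le> ennreal (1 / \<epsilon>\<^sup>2 * ((x - c)\<^sup>2 * f x))"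
      by (auto simp: indicator_def intro: ennreal_leI)
  qed
  also have "\<dots> = ennreal (1 / \<epsilon>\<^sup>2 * V)"
    using V nn by (subst nn_integral_eq_integral)
      (auto simp: has_bochner_integral_iff)
  finally show ?thesis using V0 unfolding measure_def
    by (intro enn2real_leI) auto
qed

subsection \<open>Paths of the stochastic differential equation\<close>

text \<open>The \<open>i\<close>-th point is the first grid point of mesh \<open>1 / (i + 1)\<close>
  strictly above \<open>t\<close>. Each grid is countable, which makes right-continuous functions
  and processes at random times measurable.\<close>

lemma filterlim_floor_at_right:
  "filterlim (\<lambda>i. (real_of_int \<lfloor>real (Suc i) * t\<rfloor> + 1) / real (Suc i)) (at_right t) sequentially"
proof -
  let ?a = "\<lambda>i. (real_of_int \<lfloor>real (Suc i) * t\<rfloor> + 1) / real (Suc i)"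
  have gt: "t < ?a i" for i
    by (simp add: pos_less_divide_eq mult.commute)
  have le: "?a i \<le> t + 1 / real (Suc i)" for i
  proof -
    have "?a i \<le> (real (Suc i) * t + 1) / real (Suc i)"
      by (intro divide_right_mono) auto
    then show ?thesis by (simp add: add_divide_distrib)
  qed
  have "(\<lambda>i. t + 1 / real (Suc i)) \<longlonglongrightarrow> t + 0"
    by (intro tendsto_intros LIMSEQ_Suc lim_1_over_n)
  then have "?a \<longlonglongrightarrow> t"
    by (intro tendsto_sandwich[OF always_eventually always_eventually tendsto_const,
        of t ?a "\<lambda>i. t + 1 / real (Suc i)"] allI less_imp_le[OF gt] le) simp
  then show ?thesis
    using gt by (auto simp: filterlim_at less_imp_neq[symmetric] simp del: of_nat_Suc)
qed

lemma borel_measurable_right_continuous: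
  fixes f :: "real \<Rightarrow> real"
  assumes f: "\<And>t. continuous (at_right t) f"
  shows "f \<in> borel_measurable borel"
proof (rule borel_measurable_LIMSEQ_real)
  fix t :: real
  show "(\<lambda>i. f ((real_of_int \<lfloor>real (Suc i) * t\<rfloor> + 1) / real (Suc i))) \<longlonglongrightarrow> f t"
    using f[of t] filterlim_floor_at_right[of t] by (auto simp: continuous_within intro: filterlim_compose)
next
  fix i
  show "(\<lambda>t. f ((real_of_int \<lfloor>real (Suc i) * t\<rfloor> + 1) / real (Suc i))) \<in> borel_measurable borel"
    by (rule measurable_compose[where g="\<lambda>z. f ((real_of_int z + 1) / real (Suc i))" and N="count_space UNIV"])
       measurable
qed

text \<open>The interval measure asks for right-continuity on the whole line, whereas paths are
  controlled only at nonnegative times.\<close>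

lemma continuous_clamp:
  fixes f :: "real \<Rightarrow> real"
  assumes "\<And>t. t \<ge> 0 \<Longrightarrow> continuous (at_right t) f"
  shows "continuous (at_right t) (\<lambda>s. f (max 0 s))"
proof (cases "t \<ge> 0")
  case True
  then have "(f \<longlongrightarrow> f t) (at_right t)" using assms by (simp add: continuous_within)
  moreover have "\<forall>\<^sub>F s in at_right t. f s = f (max 0 s)"
    using eventually_at_right_less[of t] by eventually_elim (use True in auto)
  ultimately show ?thesis using True
    by (simp add: continuous_within max.absorb2 tendsto_cong)
next
  case False
  then have "\<forall>\<^sub>F s in at_right t. f (max 0 s) = f 0"
    by (subst eventually_at_right_field) (auto intro!: exI[of _ 0] simp: max_def)
  with False show ?thesis
    by (simp add: continuous_within max_def tendsto_eventually)
qed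

lemma continuous_at_right_ge:
  fixes f :: "real \<Rightarrow> real"
  assumes "continuous (at_right s) f" and "\<And>t. s < t \<Longrightarrow> c \<le> f t"
  shows "c \<le> f s"
proof (rule tendsto_lowerbound)
  show "(f \<longlongrightarrow> f s) (at_right s)" using assms by (simp add: continuous_within)
  show "\<forall>\<^sub>F t in at_right s. c \<le> f t"
    using eventually_at_right_less[of s] by eventually_elim (use assms in auto)
qed simp

section \<open>Bins and the piecewise constant volatility\<close>

locale levels =
  fixes b \<sigma> :: "nat \<Rightarrow> real" and K :: nat
  assumes K: "K \<ge> 1" and b_0: "b 0 = 0" and b_less: "\<And>k. k < K \<Longrightarrow> b k < b (Suc k)"
    and \<sigma>_pos: "\<And>k. 1 \<le> k \<Longrightarrow> k \<le> K \<Longrightarrow> \<sigma> k > 0"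
begin

abbreviation "v \<equiv> volatility b K \<sigma>"

definition "\<sigma>_min = Min (\<sigma> ` {1..K})"

lemma \<sigma>_min_pos: "\<sigma>_min > 0"
  unfolding \<sigma>_min_def using K \<sigma>_pos by (subst Min_gr_iff) auto

lemma \<sigma>_min_le: "1 \<le> k \<Longrightarrow> k \<le> K \<Longrightarrow> \<sigma>_min \<le> \<sigma> k"
  unfolding \<sigma>_min_def by (intro Min_le) auto

lemma b_mono: "i \<le> j \<Longrightarrow> j \<le> K \<Longrightarrow> b i \<le> b j"
proof (induction rule: dec_induct)
  case (step n)
  then show ?case using b_less[of n] by simp
qed simp

lemma bin_unique:
  assumes "y \<in> bin b K j" "y \<in> bin b K k" "1 \<le> j" "j \<le> K" "1 \<le> k" "k \<le> K"
  shows "j = k"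
proof -
  have False if "y \<in> bin b K j" "y \<in> bin b K k" "1 \<le> j" "k \<le> K" "j < k" for j k
  proof -
    have "b j \<le> b (k - 1)" using that by (intro b_mono) auto
    moreover have "y \<le> b j" "b (k - 1) < y" using that by (auto simp: bin_def split: if_splits)
    ultimately show False by simp
  qed
  from this[of j k] this[of k j] assms show ?thesis by (meson linorder_neqE_nat)
qed

lemma volatility_bin:
  assumes "1 \<le> k" "k \<le> K" "y \<in> bin b K k"
  shows "v y = \<sigma> k"
proof -
  have "v y = (\<Sum>j=1..K. if j = k then \<sigma> k else 0)"
    unfolding volatility_def using assms bin_unique by (intro sum.cong) (auto simp: indicator_def)
  also have "\<dots> = \<sigma> k" using assms by simp
  finally show ?thesis .
qed

text \<open>No bin contains \<open>y\<close>, the last one being open at \<open>b K\<close>; hence a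
  solution stays constant once it has reached that level.\<close>

lemma volatility_above:
  assumes "b K \<le> y"
  shows "v y = 0"
  unfolding volatility_def
proof (intro sum.neutral ballI)
  fix k assume k: "k \<in> {1..K}"
  have "b k < b K" if "k < K" using b_less[of k] b_mono[of "Suc k" K] that by simp
  then have "y \<notin> bin b K k" using assms k by (cases "k = K") (auto simp: bin_def)
  then show "\<sigma> k * indicator (bin b K k) y = 0" by simp
qed

lemma bin_exists:
  assumes "0 \<le> y" "y < b K"
  obtains k where "1 \<le> k" "k \<le> K" "y \<in> bin b K k"
proof -
  \<comment> \<open>Minimality gives \<open>b (k - 1) < y\<close> unless \<open>k = 1\<close>, where
    the bin is closed at 0 instead; for \<open>k = K\<close> the strict upper bound is the
    hypothesis on \<open>y\<close>.\<close>
  define k where "k = (LEAST k. 1 \<le> k \<and> y \<le> b k)"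
  have "1 \<le> K \<and> y \<le> b K" using K assms by simp
  then have k: "1 \<le> k \<and> y \<le> b k" "k \<le> K"
    unfolding k_def by (rule LeastI, rule Least_le)
  have "b (k - 1) < y" if "k \<noteq> 1"
    using not_less_Least[of "k - 1" "\<lambda>k. 1 \<le> k \<and> y \<le> b k"] k that
    unfolding k_def[symmetric] by linarith
  then have "y \<in> bin b K k" using k assms b_0 by (auto simp: bin_def)
  with k that show thesis by blast
qed

lemma volatility_nonneg: "0 \<le> v y"
  unfolding volatility_def using \<sigma>_pos by (intro sum_nonneg) (simp add: less_imp_le)

lemma volatility_le_sum: "v y \<le> sum \<sigma> {1..K}"
  unfolding volatility_def using \<sigma>_pos
  by (intro sum_mono) (auto simp: indicator_def intro: less_imp_le)

lemma volatility_ge: "0 \<le> y \<Longrightarrow> y < b K \<Longrightarrow> \<sigma>_min \<le> v y"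
  by (metis bin_exists volatility_bin \<sigma>_min_le)

lemma volatility_eq: "k < K \<Longrightarrow> b k < y \<Longrightarrow> y < b (Suc k) \<Longrightarrow> v y = \<sigma> (Suc k)"
  by (rule volatility_bin) (auto simp: bin_def)

text \<open>Unlike in \<open>volatility_eq\<close>, the right end is included: there the value is
  \<open>\<sigma> (Suc k)\<close> for an inner bin and 0 for the last one, whence only an
  inequality.\<close>

lemma volatility_le:
  assumes "k < K" "b k < y" "y \<le> b (Suc k)"
  shows "v y \<le> \<sigma> (Suc k)"
proof (cases "y = b (Suc k) \<and> Suc k = K")
  case True
  then have "v y = 0" using volatility_above[of y] by auto
  then show ?thesis using \<sigma>_pos[of "Suc k"] assms by simp
next
  case False
  then have "y \<in> bin b K (Suc k)" using assms by (auto simp: bin_def)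
  then show ?thesis using volatility_bin[of "Suc k" y] assms by simp
qed

lemma measurable_volatility[measurable]: "v \<in> borel_measurable borel"
proof -
  have "bin b K k \<in> sets borel" for k unfolding bin_def by measurable
  then show ?thesis unfolding volatility_def by measurable
qed

end

section \<open>Deterministic analysis of one good path\<close>

locale sde_path = levels +
  fixes l x :: "real \<Rightarrow> real" and n :: nat
  assumes n: "n \<ge> 1"
    and l_less: "\<And>s t. 0 \<le> s \<Longrightarrow> s < t \<Longrightarrow> l s < l t"
    and l_right: "\<And>t. t \<ge> 0 \<Longrightarrow> continuous (at_right t) l"
    and l_unbounded: "\<And>c. \<exists>t\<ge>0. c < l t"
    and x_cadlag: "cadlag x" and x_0: "x 0 = 0"
    and x_eq: "\<And>t. t \<ge> 0 \<Longrightarrow> x t = 1 / real n * stieltjes_integral l t (\<lambda>s. v (Lim (at_left s) x))"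
begin

abbreviation "xl s \<equiv> Lim (at_left s) x"
abbreviation "\<mu> \<equiv> interval_measure (\<lambda>s. l (max 0 s))"
abbreviation "\<tau> \<equiv> hit_time b x"

lemma l_mono: "0 \<le> s \<Longrightarrow> s \<le> t \<Longrightarrow> l s \<le> l t"
  using l_less[of s t] by (cases "s = t") auto

lemma x_right: "t \<ge> 0 \<Longrightarrow> continuous (at_right t) x"
  using x_cadlag by (simp add: cadlag_def)

lemma xl_tendsto: "t > 0 \<Longrightarrow> (x \<longlongrightarrow> xl t) (at_left t)"
  using x_cadlag by (auto simp: cadlag_def tendsto_Lim)

text \<open>Left limits are limits of the values at \<open>s - 1 / (i + 1)\<close>, which depend
  measurably on \<open>s\<close> by right-continuity of \<open>x\<close>. The indicator discards
  times at which no left limit is guaranteed.\<close>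

lemma measurable_xl: "(\<lambda>s. indicator {0<..} s * xl s) \<in> borel_measurable borel"
proof (rule borel_measurable_LIMSEQ_real)
  have [measurable]: "(\<lambda>s. x (max 0 s)) \<in> borel_measurable borel"
    by (intro borel_measurable_right_continuous continuous_clamp x_right)
  show "(\<lambda>s. indicator {0<..} s * x (max 0 (s - 1 / real (Suc i)))) \<in> borel_measurable borel" for i
    by measurable
  fix s :: real
  show "(\<lambda>i. indicator {0<..} s * x (max 0 (s - 1 / real (Suc i)))) \<longlonglongrightarrow> indicator {0<..} s * xl s"
  proof (cases "s > 0")
    case True
    have "(\<lambda>i. s - 1 / real (Suc i)) \<longlonglongrightarrow> s - 0"
      by (intro tendsto_intros LIMSEQ_Suc lim_1_over_n)
    then have "(\<lambda>i. max 0 (s - 1 / real (Suc i))) \<longlonglongrightarrow> max 0 s"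
      by (intro tendsto_intros) simp
    moreover have "max 0 (s - 1 / real (Suc i)) < s" for i using True by simp
    ultimately have "filterlim (\<lambda>i. max 0 (s - 1 / real (Suc i))) (at_left s) sequentially"
      using True by (auto simp: filterlim_at less_imp_neq simp del: of_nat_Suc max_less_iff_conj)
    from filterlim_compose[OF xl_tendsto[OF True] this] True show ?thesis by simp
  qed simp
qed

lemma emeasure_\<mu>: "0 \<le> s \<Longrightarrow> s \<le> t \<Longrightarrow> emeasure \<mu> {s<..t} = l t - l s"
  by (subst emeasure_interval_measure_Ioc) (auto intro: l_mono continuous_clamp l_right)

lemma set_integrable_\<mu>_const: "0 \<le> s \<Longrightarrow> s \<le> t \<Longrightarrow> set_integrable \<mu> {s<..t} (\<lambda>_. c::real)"
  unfolding set_integrable_def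
  by (intro integrable_scaleR_left integrable_real_indicator) (simp_all add: emeasure_\<mu>)

lemma set_integral_\<mu>_const: "0 \<le> s \<Longrightarrow> s \<le> t \<Longrightarrow> (LINT u:{s<..t}|\<mu>. (c::real)) = c * (l t - l s)"
  using l_mono[of s t]
  by (simp add: set_lebesgue_integral_def measure_def emeasure_\<mu>)

lemma set_integrable_v:
  assumes "0 \<le> s" "s \<le> t"
  shows "set_integrable \<mu> {s<..t} (\<lambda>u. v (xl u))"
proof -
  have [measurable]: "(\<lambda>s. v (indicator {0<..} s * xl s)) \<in> borel_measurable borel"
    using measurable_xl by measurable
  \<comment> \<open>All times in \<open>{s<..t}\<close> are positive, so the integrand may be
    exchanged for its measurable version, which is bounded.\<close>
  have eq: "indicator {s<..t} u *\<^sub>R v (xl u) = indicator {s<..t} u *\<^sub>R v (indicator {0<..} u * xl u)" for u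
    using assms by (auto simp: indicator_def)
  have "set_integrable \<mu> {s<..t} (\<lambda>u. v (indicator {0<..} u * xl u))"
    by (rule set_integrable_bound[OF set_integrable_\<mu>_const[OF assms, of "sum \<sigma> {1..K}"]])
       (use abs_ge_self order_trans[OF volatility_le_sum] in
        \<open>auto simp: set_borel_measurable_def volatility_nonneg simp del: One_nat_def\<close>)
  then show ?thesis unfolding set_integrable_def eq .
qed

lemma x_increment:
  assumes "0 \<le> s" "s \<le> t"
  shows "real n * (x t - x s) = (LINT u:{s<..t}|\<mu>. v (xl u))"
proof -
  have "{0<..t} = {0<..s} \<union> {s<..t}" using assms by auto
  then have "(LINT u:{0<..t}|\<mu>. v (xl u)) = (LINT u:{0<..s}|\<mu>. v (xl u)) + (LINT u:{s<..t}|\<mu>. v (xl u))"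
    using assms by (simp add: set_integral_Un set_integrable_v)
  then show ?thesis using n assms by (simp add: x_eq stieltjes_integral_def field_simps)
qed

lemma x_increment_ge:
  assumes "0 \<le> s" "s \<le> t" "\<And>u. s < u \<Longrightarrow> u \<le> t \<Longrightarrow> c \<le> v (xl u)"
  shows "c * (l t - l s) \<le> real n * (x t - x s)"
  unfolding x_increment[OF assms(1,2)] set_integral_\<mu>_const[OF assms(1,2), symmetric]
  by (intro set_integral_mono set_integrable_\<mu>_const set_integrable_v) (use assms in auto)

lemma x_increment_le:
  assumes "0 \<le> s" "s \<le> t" "\<And>u. s < u \<Longrightarrow> u \<le> t \<Longrightarrow> v (xl u) \<le> c"
  shows "real n * (x t - x s) \<le> c * (l t - l s)"
  unfolding x_increment[OF assms(1,2)] set_integral_\<mu>_const[OF assms(1,2), symmetric]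
  by (intro set_integral_mono set_integrable_\<mu>_const set_integrable_v) (use assms in auto)

lemma x_mono: "0 \<le> s \<Longrightarrow> s \<le> t \<Longrightarrow> x s \<le> x t"
  using x_increment_ge[of s t 0] n by (simp add: volatility_nonneg zero_le_mult_iff)

lemma x_nonneg: "0 \<le> t \<Longrightarrow> 0 \<le> x t"
  using x_mono[of 0 t] x_0 by simp

lemma xl_ge: "0 \<le> r \<Longrightarrow> r < u \<Longrightarrow> x r \<le> xl u"
  by (rule tendsto_lowerbound[OF xl_tendsto])
     (auto simp: eventually_at_left_field intro!: exI[of _ r] x_mono)

lemma xl_le:
  assumes "0 < u" "\<And>r. 0 \<le> r \<Longrightarrow> r < u \<Longrightarrow> x r \<le> c"
  shows "xl u \<le> c"
  by (rule tendsto_upperbound[OF xl_tendsto])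
     (use assms in \<open>auto simp: eventually_at_left_field intro!: exI[of _ 0]\<close>)

lemma x_increment_\<sigma>_min:
  assumes "0 \<le> s" "s \<le> t" "x t < b K"
  shows "\<sigma>_min * (l t - l s) \<le> real n * (x t - x s)"
proof (rule x_increment_ge[OF assms(1,2)], rule volatility_ge)
  fix u assume u: "s < u" "u \<le> t"
  show "0 \<le> xl u" using xl_ge[of 0 u] u assms x_0 by simp
  have "xl u \<le> x t" by (rule xl_le) (use u assms in \<open>auto intro: x_mono\<close>)
  then show "xl u < b K" using assms by simp
qed

lemma x_reaches: "\<exists>t\<ge>0. b K \<le> x t"
proof (rule ccontr)
  assume "\<not> ?thesis"
  then have less: "x t < b K" if "t \<ge> 0" for t using that by force
  obtain t where t: "t \<ge> 0" "l 0 + real n * b K / \<sigma>_min < l t" using l_unbounded by blast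
  then have "real n * b K < \<sigma>_min * (l t - l 0)"
    using \<sigma>_min_pos by (simp add: field_simps)
  also have "\<dots> \<le> real n * x t" using x_increment_\<sigma>_min[of 0 t] t less x_0 by simp
  also have "\<dots> \<le> real n * b K" using less[of t] t by (intro mult_left_mono) auto
  finally show False by simp
qed

text \<open>Monotonicity makes the times with \<open>b k \<le> x t\<close> an up-set,
  right-continuity puts the infimum into it, and \<open>x_reaches\<close> makes it nonempty. Level 0
  is covered by the convention \<open>\<tau> 0 = 0\<close>.\<close>

lemma hit_time_nonneg: "k \<le> K \<Longrightarrow> 0 \<le> \<tau> k"
  and hit_time_le_iff: "k \<le> K \<Longrightarrow> 0 \<le> t \<Longrightarrow> \<tau> k \<le> t \<longleftrightarrow> b k \<le> x t"
proof -
  let ?S = "{t. 0 \<le> t \<and> b k \<le> x t}"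
  assume k: "k \<le> K"
  have "0 \<le> \<tau> k \<and> (\<forall>t\<ge>0. \<tau> k \<le> t \<longleftrightarrow> b k \<le> x t)"
  proof (cases "k = 0")
    case True
    then show ?thesis by (simp add: hit_time_def b_0 x_nonneg)
  next
    case False
    then have \<tau>: "\<tau> k = Inf ?S" by (simp add: hit_time_def)
    obtain t0 where "t0 \<ge> 0" "b K \<le> x t0" using x_reaches by blast
    then have ne: "?S \<noteq> {}" using b_mono[OF k] by (auto intro: order_trans)
    have bdd: "bdd_below ?S" by (rule bdd_belowI[of _ 0]) auto
    have nn: "0 \<le> \<tau> k" unfolding \<tau> by (rule cInf_greatest[OF ne]) auto
    have after: "b k \<le> x t" if "\<tau> k < t" for t
    proof -
      obtain s where "s \<in> ?S" "s < t" using \<tau> \<open>\<tau> k < t\<close> cInf_lessD[OF ne] by auto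
      then show ?thesis using x_mono[of s t] by auto
    qed
    then have "b k \<le> x (\<tau> k)" by (rule continuous_at_right_ge[OF x_right[OF nn]])
    then have "b k \<le> x t" if "\<tau> k \<le> t" for t using x_mono[OF nn that] by simp
    moreover have "\<tau> k \<le> t" if "0 \<le> t" "b k \<le> x t" for t
      unfolding \<tau> using that by (intro cInf_lower bdd) auto
    ultimately show ?thesis using nn by blast
  qed
  then show "0 \<le> \<tau> k" "0 \<le> t \<Longrightarrow> \<tau> k \<le> t \<longleftrightarrow> b k \<le> x t" by auto
qed

lemma x_hit_time: "k \<le> K \<Longrightarrow> b k \<le> x (\<tau> k)"
  using hit_time_le_iff[of k "\<tau> k"] hit_time_nonneg by simp

lemma x_less_level: "k \<le> K \<Longrightarrow> 0 \<le> t \<Longrightarrow> t < \<tau> k \<Longrightarrow> x t < b k"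
  using hit_time_le_iff[of k t] by linarith

lemma hit_time_mono:
  assumes "k < K" shows "\<tau> k \<le> \<tau> (Suc k)"
proof -
  have "b k \<le> x (\<tau> (Suc k))" using x_hit_time[of "Suc k"] b_less assms by fastforce
  then show ?thesis using hit_time_le_iff[of k "\<tau> (Suc k)"] hit_time_nonneg assms by simp
qed

text \<open>Strict monotonicity of \<open>l\<close> makes \<open>x\<close> leave the level \<open>b k\<close> at once, so that no time is
  spent with the volatility of the preceding bin.\<close>

lemma xl_gt_level:
  assumes "k < K" "\<tau> k < u" "u \<le> \<tau> (Suc k)"
  shows "b k < xl u"
proof -
  define r where "r = (\<tau> k + u) / 2"
  have nn: "0 \<le> \<tau> k" using hit_time_nonneg assms by simp
  have r: "\<tau> k < r" "r < u" using assms by (auto simp: r_def)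
  have "x r < b (Suc k)" using x_less_level[of "Suc k" r] r assms nn by simp
  also have "\<dots> \<le> b K" using b_mono assms by simp
  finally have "\<sigma>_min * (l r - l (\<tau> k)) \<le> real n * (x r - x (\<tau> k))"
    using x_increment_\<sigma>_min[of "\<tau> k" r] nn r by simp
  moreover have "0 < \<sigma>_min * (l r - l (\<tau> k))" using \<sigma>_min_pos l_less[of "\<tau> k" r] nn r by simp
  ultimately have "0 < real n * (x r - x (\<tau> k))" by simp
  then have "x (\<tau> k) < x r" using n by (simp add: zero_less_mult_iff)
  then show ?thesis using x_hit_time[of k] assms xl_ge[of r u] nn r by simp
qed

text \<open>Between \<open>\<tau> k\<close> and \<open>t\<close> the left limits stay strictly
  inside bin \<open>Suc k\<close>, so the volatility is exactly \<open>\<sigma> (Suc k)\<close>; as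
  \<open>x t\<close> is still below the level, the gain of the driver is capped. The overshoot at
  \<open>\<tau> k\<close> enters through \<open>x (\<tau> k)\<close>.\<close>

lemma l_before_hit:
  assumes "k < K" "\<tau> k \<le> t" "t < \<tau> (Suc k)"
  shows "\<sigma> (Suc k) * (l t - l (\<tau> k)) \<le> real n * (b (Suc k) - x (\<tau> k))"
proof -
  have nn: "0 \<le> \<tau> k" using hit_time_nonneg assms by simp
  have less: "x t < b (Suc k)" using x_less_level[of "Suc k" t] assms nn by simp
  have "\<sigma> (Suc k) * (l t - l (\<tau> k)) \<le> real n * (x t - x (\<tau> k))"
  proof (rule x_increment_ge[OF nn assms(2)])
    fix u assume u: "\<tau> k < u" "u \<le> t"
    have "xl u \<le> x t" by (rule xl_le) (use u nn in \<open>auto intro: x_mono\<close>)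
    moreover have "b k < xl u" using xl_gt_level u assms by simp
    ultimately show "\<sigma> (Suc k) \<le> v (xl u)" using volatility_eq[of k "xl u"] assms less by simp
  qed
  also have "\<dots> \<le> real n * (b (Suc k) - x (\<tau> k))"
    using less by (intro mult_left_mono) auto
  finally show ?thesis .
qed

text \<open>Only an inequality: a jump of \<open>l\<close> at a time when \<open>x\<close> creeps up to \<open>b K\<close> has no effect on
  \<open>x\<close>, because the last bin is open at \<open>b K\<close>.\<close>

lemma x_increment_hit:
  assumes "k < K"
  shows "real n * (x (\<tau> (Suc k)) - x (\<tau> k)) \<le> \<sigma> (Suc k) * (l (\<tau> (Suc k)) - l (\<tau> k))"
proof (rule x_increment_le[OF _ hit_time_mono[OF assms]])
  show nn: "0 \<le> \<tau> k" using hit_time_nonneg assms by simp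
  fix u assume u: "\<tau> k < u" "u \<le> \<tau> (Suc k)"
  have "xl u \<le> b (Suc k)"
    by (rule xl_le) (use u nn assms x_less_level[of "Suc k"] in \<open>auto intro: less_imp_le\<close>)
  then show "v (xl u) \<le> \<sigma> (Suc k)" using volatility_le[of k "xl u"] xl_gt_level u assms by simp
qed

lemma delta_time_nonneg: "k < K \<Longrightarrow> 0 \<le> delta_time b x (Suc k)"
  using hit_time_mono by (simp add: delta_time_def)

lemma delta_path_nonneg: "k < K \<Longrightarrow> 0 \<le> delta_path b x (Suc k)"
  using hit_time_mono[of k] hit_time_nonneg[of k] by (simp add: delta_path_def x_mono)

end

context sde_path
begin

text \<open>Both \<open>\<tau> (Suc k)\<close> and the overshoot at that time are controlled by the values of \<open>l\<close> at
  two deterministic times \<open>s1\<close> and \<open>s2\<close> that enclose the typical value of \<open>\<tau> (Suc k)\<close>.\<close>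

lemma hit_time_step:
  fixes \<gamma> c c' C r \<rho> \<delta> s1 s2 :: real
  assumes k: "k < K" and c'_def: "c' = c + (b (Suc k) - b k) / \<sigma> (Suc k)"
    and s1_def: "s1 = real n * c' / \<gamma> - \<rho> * r" and s2_def: "s2 = real n * c' / \<gamma> + \<rho> * r"
    and "\<gamma> > 0" "r > 0" "\<rho> \<ge> 0" "C \<ge> 0" and s1: "0 \<le> s1"
    and l_c: "\<bar>l (\<tau> k) - real n * c\<bar> \<le> C * r"
    and x_b: "real n * \<bar>x (\<tau> k) - b k\<bar> \<le> C * r"
    and l_s1: "\<bar>l s1 - \<gamma> * s1\<bar> \<le> \<delta> * r" and l_s2: "\<bar>l s2 - \<gamma> * s2\<bar> \<le> \<delta> * r"
    and \<rho>: "\<delta> + C + C / \<sigma> (Suc k) < \<gamma> * \<rho>"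
  shows "\<bar>\<tau> (Suc k) - real n * c' / \<gamma>\<bar> \<le> \<rho> * r"
    and "\<bar>l (\<tau> (Suc k)) - real n * c'\<bar> \<le> (\<gamma> * \<rho> + \<delta>) * r"
    and "real n * \<bar>x (\<tau> (Suc k)) - b (Suc k)\<bar> \<le> (C + \<sigma> (Suc k) * (\<gamma> * \<rho> + \<delta> + C)) * r"
proof -
  define S d where "S = \<sigma> (Suc k)" and "d = (b (Suc k) - b k) / S"
  have S: "S > 0" using \<sigma>_pos k by (simp add: S_def)
  have d: "S * d = b (Suc k) - b k" "d > 0" using S b_less[OF k] by (simp_all add: d_def)
  have c': "c' = c + d" by (simp add: c'_def d_def S_def)
  have nc': "real n * c' = real n * c + real n * d" by (simp add: c' algebra_simps)
  have nd: "real n * d \<ge> 0" using d by simp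
  have \<gamma>s: "\<gamma> * s1 = real n * c' - \<gamma> * \<rho> * r" "\<gamma> * s2 = real n * c' + \<gamma> * \<rho> * r"
    using \<open>\<gamma> > 0\<close> by (simp_all add: s1_def s2_def field_simps)
  have s12: "0 \<le> s2"
    using s1 mult_nonneg_nonneg[of \<rho> r] \<open>\<rho> \<ge> 0\<close> \<open>r > 0\<close> unfolding s1_def s2_def by linarith
  have \<rho>r: "\<delta> * r + C * r + C / S * r < \<gamma> * \<rho> * r"
    using mult_strict_right_mono[OF \<rho> \<open>r > 0\<close>] by (simp add: S_def algebra_simps)
  have Cr: "0 \<le> C / S * r" using S \<open>C \<ge> 0\<close> \<open>r > 0\<close> by simp
  have \<tau>: "0 \<le> \<tau> k" "0 \<le> \<tau> (Suc k)" using hit_time_nonneg k by simp_all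
  have n_b: "real n * (b (Suc k) - b k) = S * (real n * d)" by (simp flip: d(1))
  have xk: "b k \<le> x (\<tau> k)" using x_hit_time k by simp
  have xk': "b (Suc k) \<le> x (\<tau> (Suc k))" using x_hit_time k by simp
  \<comment> \<open>Were the level not reached by \<open>s2\<close>, the driver would have gained at
    most \<open>n * d\<close> since \<open>\<tau> k\<close>; yet \<open>l s2\<close> is at least
    \<open>n * c' + (\<gamma> * \<rho> - \<delta>) * r\<close>, which exceeds
    \<open>n * c' + C * r\<close> by the condition on \<open>\<rho>\<close>.\<close>
  have upper: "\<tau> (Suc k) \<le> s2"
  proof (rule ccontr)
    assume "\<not> \<tau> (Suc k) \<le> s2"
    then have less: "s2 < \<tau> (Suc k)" by simp
    have "l s2 \<le> l (\<tau> k) + real n * d"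
    proof (cases "\<tau> k \<le> s2")
      case True
      have "S * (l s2 - l (\<tau> k)) \<le> real n * (b (Suc k) - x (\<tau> k))"
        using l_before_hit[OF k True less] by (simp add: S_def)
      also have "\<dots> \<le> real n * (b (Suc k) - b k)" using xk by (intro mult_left_mono) auto
      finally show ?thesis using S by (simp add: n_b)
    next
      case False
      then show ?thesis using l_mono[of s2 "\<tau> k"] s12 nd by simp
    qed
    with l_c l_s2 \<gamma>s \<rho>r Cr nc' show False by linarith
  qed
  have inc: "real n * (x (\<tau> (Suc k)) - x (\<tau> k)) \<le> S * (l (\<tau> (Suc k)) - l (\<tau> k))"
    using x_increment_hit[OF k] by (simp add: S_def)
  have x_b': "real n * (x (\<tau> k) - b k) \<le> C * r" using x_b xk by simp
  \<comment> \<open>The overshoot at level \<open>k\<close> saves the driver at most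
    \<open>C / S * r\<close>; this accounts for the last summand in the condition on
    \<open>\<rho>\<close>.\<close>
  have lower: "s1 \<le> \<tau> (Suc k)"
  proof (rule ccontr)
    assume "\<not> s1 \<le> \<tau> (Suc k)"
    then have less: "l (\<tau> (Suc k)) \<le> l s1" using l_mono \<tau> by simp
    have "real n * (b (Suc k) - x (\<tau> k)) = S * (real n * d) - real n * (x (\<tau> k) - b k)"
      unfolding n_b[symmetric] by (simp add: algebra_simps)
    then have "S * (real n * d) - C * r \<le> real n * (b (Suc k) - x (\<tau> k))"
      using x_b' by simp
    also have "\<dots> \<le> real n * (x (\<tau> (Suc k)) - x (\<tau> k))"
      using xk' by (intro mult_left_mono) auto
    also note inc
    finally have "real n * d - C / S * r \<le> l (\<tau> (Suc k)) - l (\<tau> k)"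
      using S by (simp add: field_simps)
    with l_c l_s1 \<gamma>s \<rho>r less nc' show False by linarith
  qed
  show "\<bar>\<tau> (Suc k) - real n * c' / \<gamma>\<bar> \<le> \<rho> * r"
    using upper lower by (simp add: s1_def s2_def abs_le_iff)
  have "l s1 \<le> l (\<tau> (Suc k))" "l (\<tau> (Suc k)) \<le> l s2"
    using l_mono s1 \<tau> lower upper by auto
  then show l': "\<bar>l (\<tau> (Suc k)) - real n * c'\<bar> \<le> (\<gamma> * \<rho> + \<delta>) * r"
    using l_s1 l_s2 \<gamma>s by (simp add: abs_le_iff algebra_simps)
  \<comment> \<open>The new overshoot is the increment plus the old overshoot minus the width of the
    bin; the excess of the driver over \<open>n * d\<close> controls it.\<close>
  have "real n * (x (\<tau> (Suc k)) - b (Suc k)) =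
      real n * (x (\<tau> (Suc k)) - x (\<tau> k)) + real n * (x (\<tau> k) - b k) - S * (real n * d)"
    unfolding n_b[symmetric] by (simp add: algebra_simps)
  also have "\<dots> \<le> S * (l (\<tau> (Suc k)) - l (\<tau> k) - real n * d) + C * r"
    using inc x_b' by (simp add: algebra_simps)
  also have "\<dots> \<le> S * ((\<gamma> * \<rho> + \<delta>) * r + C * r) + C * r"
    using S l' l_c nc' by (intro add_right_mono mult_left_mono) auto
  finally show "real n * \<bar>x (\<tau> (Suc k)) - b (Suc k)\<bar> \<le> (C + \<sigma> (Suc k) * (\<gamma> * \<rho> + \<delta> + C)) * r"
    using xk' by (simp add: S_def algebra_simps)
qed

end


subsection \<open>Concentration of the hitting times\<close>

text \<open>In a complete measure space a change on a null set preserves measurability;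
  \<open>g\<close> may thus be a path functional that is well behaved only almost surely.\<close>

lemma measurable_completion_AE:
  fixes f g :: "'a \<Rightarrow> real"
  assumes f: "f \<in> borel_measurable (completion M)" and eq: "AE \<omega> in M. f \<omega> = g \<omega>"
  shows "g \<in> borel_measurable (completion M)"
proof (rule measurableI)
  fix A :: "real set" assume A: "A \<in> sets borel"
  show "g -` A \<inter> space (completion M) \<in> sets (completion M)"
  proof (rule completion.in_sets_AE)
    show "f -` A \<inter> space (completion M) \<in> sets (completion M)"
      using f A by (rule measurable_sets)
    show "AE \<omega> in completion M. \<omega> \<in> f -` A \<inter> space (completion M) \<longleftrightarrow> \<omega> \<in> g -` A \<inter> space (completion M)"
      using AE_completion[OF eq] by eventually_elim auto
  qed simp
qed simp

text \<open>Reduces strict monotonicity to countably many pairs of times, as an almost sure argument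
  requires. Two rationals \<open>p < q\<close> between \<open>s\<close> and \<open>t\<close>
  preserve strictness, while right-continuity gives \<open>l s \<le> l p\<close> and
  \<open>l q \<le> l t\<close>.\<close>

lemma strict_mono_of_rationals:
  fixes l :: "real \<Rightarrow> real"
  assumes right: "\<And>t. t \<ge> 0 \<Longrightarrow> continuous (at_right t) l"
    and rat: "\<And>p q. p \<in> \<rat> \<Longrightarrow> q \<in> \<rat> \<Longrightarrow> 0 \<le> p \<Longrightarrow> p < q \<Longrightarrow> l p < l q"
    and "0 \<le> s" "s < t"
  shows "l s < l t"
proof -
  obtain p where p: "p \<in> \<rat>" "s < p" "p < t" using Rats_dense_in_real[OF \<open>s < t\<close>] by blast
  obtain q where q: "q \<in> \<rat>" "p < q" "q < t" using Rats_dense_in_real[OF \<open>p < t\<close>] by blast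
  have dense: "\<exists>a\<in>\<rat>. u < a \<and> a < w" if "u < w" for u w :: real
    using Rats_dense_in_real[OF that] by blast
  have "l s \<le> l p"
  proof (rule ccontr)
    assume "\<not> ?thesis"
    then have "\<forall>\<^sub>F u in at_right s. l p < l u"
      using right[OF \<open>0 \<le> s\<close>] by (intro order_tendstoD(1)[of l "l s"]) (auto simp: continuous_within)
    then obtain e where e: "e > s" "\<And>u. s < u \<Longrightarrow> u < e \<Longrightarrow> l p < l u"
      by (auto simp: eventually_at_right_field)
    obtain a where "a \<in> \<rat>" "s < a" "a < min e p" using dense[of s "min e p"] e p by auto
    then show False using e(2)[of a] rat[of a p] p \<open>0 \<le> s\<close> by force
  qed
  also have "l p < l q" using rat p q \<open>0 \<le> s\<close> by simp
  also have "l q \<le> l t"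
  proof (rule ccontr)
    assume "\<not> ?thesis"
    then have "\<forall>\<^sub>F u in at_right t. l u < l q"
      using right[of t] assms by (intro order_tendstoD(2)[of l "l t"]) (auto simp: continuous_within)
    then obtain e where e: "e > t" "\<And>u. t < u \<Longrightarrow> u < e \<Longrightarrow> l u < l q"
      by (auto simp: eventually_at_right_field)
    obtain a where "a \<in> \<rat>" "t < a" "a < e" using dense[of t e] e by auto
    then show False using e(2)[of a] rat[of q a] p q \<open>0 \<le> s\<close> by force
  qed
  finally show ?thesis .
qed

lemma measure_inverse_gamma_tail:
  assumes "a > 2" "c > 0" "\<eta> > 0"
  shows "measure (inverse_gamma a c) {x. \<bar>x - s\<bar> > \<eta>} \<le>
    ((c - s * (a - 2))\<^sup>2 + s\<^sup>2 * (a - 2)) / ((a - 1) * (a - 2)) / \<eta>\<^sup>2"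
  unfolding inverse_gamma_def
  by (rule measure_density_Chebyshev[OF _ _ inverse_gamma_second_moment])
     (use assms in \<open>auto intro: inverse_gamma_density_nonneg\<close>)

text \<open>The reciprocal Gamma function is continuous on the whole line, so in this form joint
  measurability in the parameters and \<open>x\<close> does not have to avoid the poles of
  \<open>Gamma\<close>.\<close>

lemma inverse_gamma_density_rGamma:
  "inverse_gamma_density a b x =
     (if 0 < x then b powr a * rGamma a * x powr (- a - 1) * exp (- (b / x)) else 0)"
  by (simp add: inverse_gamma_density_def rGamma_inverse_Gamma divide_inverse)

lemma measurable_measure_inverse_gamma:
  assumes [measurable]: "f \<in> borel_measurable N" "g \<in> borel_measurable N" "A \<in> sets borel"
  shows "(\<lambda>\<omega>. measure (inverse_gamma (f \<omega>) (g \<omega>)) A) \<in> borel_measurable N"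
proof -
  have [measurable]: "(rGamma :: real \<Rightarrow> real) \<in> borel_measurable borel"
    by (intro borel_measurable_continuous_onI continuous_on_rGamma)
  have "(\<lambda>\<omega>. \<integral>\<^sup>+x. ennreal (inverse_gamma_density (f \<omega>) (g \<omega>) x) * indicator A x \<partial>lborel) \<in> borel_measurable N"
    unfolding inverse_gamma_density_rGamma by measurable
  moreover have "measure (inverse_gamma (f \<omega>) (g \<omega>)) A =
      enn2real (\<integral>\<^sup>+x. ennreal (inverse_gamma_density (f \<omega>) (g \<omega>) x) * indicator A x \<partial>lborel)" for \<omega>
    unfolding measure_def inverse_gamma_def by (subst emeasure_density) auto
  ultimately show ?thesis by simp
qed

section \<open>Almost sure properties of the gamma driver\<close>

locale volatility_model = prob_space M + levels b \<sigma> K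
  for M :: "'a measure" and b \<sigma> :: "nat \<Rightarrow> real" and K :: nat +
  fixes L :: "real \<Rightarrow> 'a \<Rightarrow> real" and X :: "nat \<Rightarrow> real \<Rightarrow> 'a \<Rightarrow> real" and \<alpha> \<beta> :: real
  assumes \<alpha>: "\<alpha> > 0" and \<beta>: "\<beta> > 0"
    and L: "gamma_process M \<alpha> \<beta> L"
    and X: "\<And>n. n \<ge> 1 \<Longrightarrow> sde_solution M L b K \<sigma> n (X n)"
begin

lemma measurable_L[measurable]: "t \<ge> 0 \<Longrightarrow> L t \<in> borel_measurable M"
  using L by (simp add: gamma_process_def levy_process_def)

lemma measurable_X[measurable]: "n \<ge> 1 \<Longrightarrow> t \<ge> 0 \<Longrightarrow> X n t \<in> borel_measurable M"
  using X by (simp add: sde_solution_def)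

lemma AE_L: "AE \<omega> in M. L 0 \<omega> = 0" "AE \<omega> in M. cadlag (\<lambda>t. L t \<omega>)"
  using L by (simp_all add: gamma_process_def levy_process_def)

lemma L_distributed:
  "0 \<le> s \<Longrightarrow> s < t \<Longrightarrow> distributed M lborel (\<lambda>\<omega>. L t \<omega> - L s \<omega>) (gamma_density (\<alpha> * (t - s)) \<beta>)"
  using L by (simp add: gamma_process_def)

lemma distr_L: "0 \<le> s \<Longrightarrow> s < t \<Longrightarrow>
    distr M lborel (\<lambda>\<omega>. L t \<omega> - L s \<omega>) = density lborel (\<lambda>x. ennreal (gamma_density (\<alpha> * (t - s)) \<beta> x))"
  using L_distributed by (simp add: distributed_def)

text \<open>The increment from time 0 has mean \<open>\<alpha> * t / \<beta>\<close> and variance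
  \<open>\<alpha> * t / \<beta>\<^sup>2\<close>. The term \<open>L 0\<close> is kept because it
  vanishes only almost surely.\<close>

lemma L_Chebyshev:
  assumes t: "t > 0" and \<eta>: "\<eta> > 0"
  shows "prob {\<omega> \<in> space M. \<bar>L t \<omega> - L 0 \<omega> - \<alpha> * t / \<beta>\<bar> > \<eta>} \<le> \<alpha> * t / (\<beta>\<^sup>2 * \<eta>\<^sup>2)"
proof -
  let ?A = "{x. \<bar>x - \<alpha> * t / \<beta>\<bar> > \<eta>}"
  have "prob {\<omega> \<in> space M. \<bar>L t \<omega> - L 0 \<omega> - \<alpha> * t / \<beta>\<bar> > \<eta>} =
      measure (distr M lborel (\<lambda>\<omega>. L t \<omega> - L 0 \<omega>)) ?A"
    using t by (subst measure_distr) (auto intro!: arg_cong[where f=prob])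
  also have "\<dots> \<le> (\<alpha> * t / \<beta>\<^sup>2) / \<eta>\<^sup>2"
    unfolding distr_L[OF order_refl t] using gamma_second_moment[of "\<alpha> * t" \<beta>] t \<alpha> \<beta> \<eta>
    by (intro measure_density_Chebyshev) (auto intro: gamma_density_nonneg)
  finally show ?thesis by simp
qed

lemma AE_L_less:
  assumes "0 \<le> s" "s < t"
  shows "AE \<omega> in M. L s \<omega> < L t \<omega>"
proof -
  have "AE x in density lborel (\<lambda>x. ennreal (gamma_density (\<alpha> * (t - s)) \<beta> x)). 0 < x"
    by (subst AE_density) (auto simp: gamma_density_def)
  then have "AE x in distr M lborel (\<lambda>\<omega>. L t \<omega> - L s \<omega>). 0 < x" unfolding distr_L[OF assms] .
  then show ?thesis using assms by (subst (asm) AE_distr_iff) auto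
qed

lemma AE_L_rationals: "AE \<omega> in M. \<forall>p\<in>\<rat>. \<forall>q\<in>\<rat>. 0 \<le> p \<longrightarrow> p < q \<longrightarrow> L p \<omega> < L q \<omega>"
  by (intro AE_ball_countable[THEN iffD2] countable_rat ballI) (auto intro: AE_L_less)

text \<open>Mean and variance of \<open>L i\<close> both grow linearly, so by Chebyshev the
  probability of never exceeding \<open>c\<close> at integer times is at most
  \<open>4 / (\<alpha> * i)\<close> for every large \<open>i\<close>.\<close>

lemma AE_L_exceeds: "AE \<omega> in M. \<exists>i::nat. c < L (real i) \<omega>"
proof -
  let ?B = "{\<omega> \<in> space M. \<forall>i. L (real i) \<omega> \<le> c}"
  have "(\<lambda>i. 4 / (\<alpha> * real i)) \<longlonglongrightarrow> 0"
    using lim_const_over_n[of "4 / \<alpha>"] by simp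
  moreover have "\<forall>\<^sub>F i in sequentially. prob ?B \<le> 4 / (\<alpha> * real i)"
  proof -
    have "\<forall>\<^sub>F i in sequentially. 2 * \<beta> * \<bar>c\<bar> / \<alpha> < real i"
      by (rule filterlim_real_sequentially[THEN filterlim_at_top_dense[THEN iffD1], rule_format])
    then show ?thesis
      using eventually_gt_at_top[of 0]
    proof eventually_elim
      case (elim i)
      \<comment> \<open>Half the mean of \<open>L i\<close>: once it exceeds
        \<open>\<bar>c\<bar>\<close>, a value of at most \<open>c\<close> misses the mean by more
        than \<open>?\<eta>\<close>.\<close>
      let ?\<eta> = "\<alpha> * real i / (2 * \<beta>)"
      have "\<bar>c\<bar> < ?\<eta>" using elim \<alpha> \<beta> by (simp add: field_simps)
      then have c: "c < ?\<eta>" "?\<eta> > 0" by linarith+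
      have "prob ?B \<le> prob {\<omega> \<in> space M. \<bar>L (real i) \<omega> - L 0 \<omega> - \<alpha> * real i / \<beta>\<bar> > ?\<eta>}"
      proof (rule finite_measure_mono_AE)
        show "AE \<omega> in M. \<omega> \<in> ?B \<longrightarrow> \<omega> \<in> {\<omega> \<in> space M. \<bar>L (real i) \<omega> - L 0 \<omega> - \<alpha> * real i / \<beta>\<bar> > ?\<eta>}"
          using AE_L(1)
        proof eventually_elim
          case (elim \<omega>)
          have "\<alpha> * real i / \<beta> = 2 * ?\<eta>" by simp
          then show ?case using c elim by (auto dest!: spec[of _ i])
        qed
      qed measurable
      also have "\<dots> \<le> \<alpha> * real i / (\<beta>\<^sup>2 * ?\<eta>\<^sup>2)" using elim c by (intro L_Chebyshev) auto
      also have "\<dots> = 4 / (\<alpha> * real i)" using elim \<alpha> \<beta> by (simp add: power2_eq_square field_simps)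
      finally show ?case .
    qed
  qed
  ultimately have "prob ?B \<le> 0"
    by (intro tendsto_lowerbound) auto
  then have "prob ?B = 0" using measure_nonneg[of M ?B] by linarith
  moreover have "?B \<in> sets M" by measurable
  ultimately have "AE \<omega> in M. \<omega> \<notin> ?B"
    by (intro AE_not_in) (simp add: null_sets_def emeasure_eq_measure)
  then show ?thesis using AE_space by eventually_elim (auto simp: not_le)
qed

text \<open>Every path condition is reduced to countably many almost sure ones: integer thresholds
  for unboundedness, rational times for strict monotonicity.\<close>

lemma AE_sde_path:
  assumes "n \<ge> 1"
  shows "AE \<omega> in M. sde_path b \<sigma> K (\<lambda>t. L t \<omega>) (\<lambda>t. X n t \<omega>) n"
proof -
  have "AE \<omega> in M. \<forall>j::nat. \<exists>i::nat. real j < L (real i) \<omega>"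
    by (intro AE_all_countable[THEN iffD2] allI AE_L_exceeds)
  moreover have "AE \<omega> in M. cadlag (\<lambda>t. X n t \<omega>)"
    and "AE \<omega> in M. X n 0 \<omega> = 0 \<and> (\<forall>t\<ge>0. X n t \<omega> = 1 / real n * stieltjes_integral (\<lambda>s. L s \<omega>) t
         (\<lambda>s. volatility b K \<sigma> (Lim (at_left s) (\<lambda>r. X n r \<omega>))))"
    using X[OF assms] by (auto simp: sde_solution_def)
  ultimately show ?thesis
    using AE_L(2) AE_L_rationals
  proof eventually_elim
    case (elim \<omega>)
    have right: "continuous (at_right t) (\<lambda>t. L t \<omega>)" if "t \<ge> 0" for t
      using elim that by (simp add: cadlag_def)
    have unb: "\<exists>t\<ge>0. c < L t \<omega>" for c
    proof -
      obtain j :: nat where "c < real j" using reals_Archimedean2 by blast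
      moreover obtain i :: nat where "real j < L (real i) \<omega>" using elim by blast
      ultimately show ?thesis by (intro exI[of _ "real i"]) simp
    qed
    show ?case
      by unfold_locales
         (use assms elim right unb strict_mono_of_rationals[of "\<lambda>t. L t \<omega>"] in auto)
  qed
qed

end

section \<open>Estimates on the square root scale\<close>

lemma eventually_sqrt_less:
  fixes a e :: real
  assumes "e > 0"
  shows "\<forall>\<^sub>F n in sequentially. a * sqrt (real n) < e * real n"
proof -
  have "filterlim (\<lambda>n. sqrt (real n)) at_top sequentially"
    by (rule filterlim_compose[OF sqrt_at_top filterlim_real_sequentially])
  then have "\<forall>\<^sub>F n in sequentially. a / e < sqrt (real n)" by (simp add: filterlim_at_top_dense)
  then show ?thesis
    using eventually_gt_at_top[of 0]
  proof eventually_elim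
    case (elim n)
    then have "a < e * sqrt (real n)" using assms by (simp add: field_simps)
    then have "a * sqrt (real n) < e * sqrt (real n) * sqrt (real n)"
      using elim by (intro mult_strict_right_mono) auto
    then show ?case by (simp add: mult.assoc)
  qed
qed

lemma measure_PiM_component:
  assumes "\<And>i. i \<in> I \<Longrightarrow> prob_space (N i)" "k \<in> I" "A \<in> sets (N k)"
  shows "measure (PiM I N) {\<xi> \<in> space (PiM I N). \<xi> k \<in> A} = measure (N k) A"
proof -
  have "measure (N k) A = measure (distr (PiM I N) (N k) (\<lambda>\<xi>. \<xi> k)) A"
    using distr_PiM_component[of I N k] assms by simp
  also have "\<dots> = measure (PiM I N) ((\<lambda>\<xi>. \<xi> k) -` A \<inter> space (PiM I N))"
    using assms by (intro measure_distr) auto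
  also have "(\<lambda>\<xi>. \<xi> k) -` A \<inter> space (PiM I N) = {\<xi> \<in> space (PiM I N). \<xi> k \<in> A}" by auto
  finally show ?thesis by simp
qed

text \<open>The second moment about \<open>s\<close> is at most a constant over \<open>n\<close>:
  its numerator is of order \<open>n\<close>, its denominator of order \<open>n\<^sup>2\<close>.
  Division by \<open>(m / sqrt n)\<^sup>2\<close> cancels \<open>n\<close> and leaves
  \<open>1 / m\<^sup>2\<close>.\<close>

lemma measure_inverse_gamma_tail_asymp:
  fixes n :: nat
  assumes "n \<ge> 1" "p > 0" "c > 0" "m > 0"
    and a: "\<bar>a - 2 - real n * p\<bar> \<le> U * sqrt (real n)"
    and c: "\<bar>c - s * (a - 2)\<bar> \<le> W * sqrt (real n)"
    and U: "U * sqrt (real n) \<le> p / 2 * real n"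
  shows "measure (inverse_gamma a c) {x. \<bar>x - s\<bar> > m / sqrt (real n)} \<le> (4 * W\<^sup>2 / p\<^sup>2 + 2 * s\<^sup>2 / p) / m\<^sup>2"
proof -
  \<comment> \<open>Half the leading term of the shape; by the bound on \<open>U * sqrt n\<close> it
    is a lower bound for \<open>a - 2\<close>.\<close>
  define q where "q = p / 2 * real n"
  have q: "q > 0" "q \<le> a - 2" using assms by (auto simp: q_def abs_le_iff algebra_simps)
  have "((c - s * (a - 2))\<^sup>2 + s\<^sup>2 * (a - 2)) / ((a - 1) * (a - 2)) \<le>
      ((c - s * (a - 2))\<^sup>2 + s\<^sup>2 * (a - 2)) / ((a - 2) * (a - 2))"
    using q by (intro divide_left_mono mult_right_mono add_nonneg_nonneg mult_pos_pos mult_nonneg_nonneg) auto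
  also have "\<dots> = (c - s * (a - 2))\<^sup>2 / (a - 2)\<^sup>2 + s\<^sup>2 / (a - 2)"
    using q by (simp add: add_divide_distrib power2_eq_square)
  also have "\<dots> \<le> (W * sqrt (real n))\<^sup>2 / q\<^sup>2 + s\<^sup>2 / q"
  proof (intro add_mono frac_le)
    show "(c - s * (a - 2))\<^sup>2 \<le> (W * sqrt (real n))\<^sup>2"
      using c by (intro abs_le_square_iff[THEN iffD1]) simp
    show "q\<^sup>2 \<le> (a - 2)\<^sup>2" using q by (intro power_mono) auto
  qed (use q in auto)
  also have "\<dots> = (4 * W\<^sup>2 / p\<^sup>2 + 2 * s\<^sup>2 / p) / real n"
    using \<open>n \<ge> 1\<close> \<open>p > 0\<close> by (simp add: q_def power2_eq_square field_simps)
  finally have V: "((c - s * (a - 2))\<^sup>2 + s\<^sup>2 * (a - 2)) / ((a - 1) * (a - 2)) \<le>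
    (4 * W\<^sup>2 / p\<^sup>2 + 2 * s\<^sup>2 / p) / real n" .
  have "measure (inverse_gamma a c) {x. \<bar>x - s\<bar> > m / sqrt (real n)} \<le>
    ((c - s * (a - 2))\<^sup>2 + s\<^sup>2 * (a - 2)) / ((a - 1) * (a - 2)) / (m / sqrt (real n))\<^sup>2"
    using assms q by (intro measure_inverse_gamma_tail) auto
  also have "\<dots> \<le> (4 * W\<^sup>2 / p\<^sup>2 + 2 * s\<^sup>2 / p) / real n / (m / sqrt (real n))\<^sup>2"
    by (intro divide_right_mono V) simp
  also have "\<dots> = (4 * W\<^sup>2 / p\<^sup>2 + 2 * s\<^sup>2 / p) / m\<^sup>2"
    using \<open>n \<ge> 1\<close> by (simp add: power_divide)
  finally show ?thesis .
qed

section \<open>Measurability and concentration at the hitting times\<close>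

context volatility_model
begin

text \<open>Almost surely, \<open>\<tau> k \<le> a\<close> amounts to the single-time event
  \<open>b k \<le> X n a\<close> for \<open>a \<ge> 0\<close> and is impossible for
  \<open>a < 0\<close>; \<open>max 0 a\<close> keeps the time index in range.\<close>

lemma measurable_hit_time:
  assumes "n \<ge> 1" "k \<le> K"
  shows "(\<lambda>\<omega>. hit_time b (\<lambda>t. X n t \<omega>) k) \<in> borel_measurable (completion M)"
  unfolding borel_measurable_iff_le
proof
  fix a
  show "{\<omega> \<in> space (completion M). hit_time b (\<lambda>t. X n t \<omega>) k \<le> a} \<in> sets (completion M)"
  proof (rule completion.in_sets_AE)
    show "AE \<omega> in completion M. \<omega> \<in> {\<omega> \<in> space M. 0 \<le> a \<and> b k \<le> X n (max 0 a) \<omega>} \<longleftrightarrow>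
        \<omega> \<in> {\<omega> \<in> space (completion M). hit_time b (\<lambda>t. X n t \<omega>) k \<le> a}"
      using AE_completion[OF AE_sde_path[OF assms(1)]]
    proof eventually_elim
      case (elim \<omega>)
      then interpret sde_path b \<sigma> K "\<lambda>t. L t \<omega>" "\<lambda>t. X n t \<omega>" n .
      show ?case using hit_time_le_iff[of k a] hit_time_nonneg[of k] assms
        by (cases "0 \<le> a") auto
    qed
    show "{\<omega> \<in> space M. 0 \<le> a \<and> b k \<le> X n (max 0 a) \<omega>} \<in> sets (completion M)"
      using assms by (intro sets_completionI_sets) measurable
  qed auto
qed

text \<open>Rounding the hitting time up to a grid leaves countably many times, so the process there
  is measurable; right-continuity recovers the value at the hitting time as the mesh
  shrinks.\<close>

lemma measurable_X_hit_time:
  assumes "n \<ge> 1" "k \<le> K"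
  shows "(\<lambda>\<omega>. X n (hit_time b (\<lambda>t. X n t \<omega>) k) \<omega>) \<in> borel_measurable (completion M)"
proof -
  define \<tau> where "\<tau> \<omega> = hit_time b (\<lambda>t. X n t \<omega>) k" for \<omega>
  have [measurable]: "\<tau> \<in> borel_measurable (completion M)"
    unfolding \<tau>_def by (rule measurable_hit_time[OF assms])
  let ?t = "\<lambda>i z. (real_of_int z + 1) / real (Suc i)"
  have "(\<lambda>\<omega>. X n (max 0 (?t i \<lfloor>real (Suc i) * \<tau> \<omega>\<rfloor>)) \<omega>) \<in> borel_measurable (completion M)" for i
    by (rule measurable_compose_countable[of "\<lambda>z \<omega>. X n (max 0 (?t i z)) \<omega>"])
       (use assms in \<open>auto intro: measurable_completion\<close>)
  \<comment> \<open>\<open>lim\<close> is measurable whether or not the sequence converges; the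
    intended value is guaranteed on the good paths only.\<close>
  then have "(\<lambda>\<omega>. lim (\<lambda>i. X n (max 0 (?t i \<lfloor>real (Suc i) * \<tau> \<omega>\<rfloor>)) \<omega>)) \<in> borel_measurable (completion M)"
    by (rule borel_measurable_lim_metric)
  moreover have "AE \<omega> in M. lim (\<lambda>i. X n (max 0 (?t i \<lfloor>real (Suc i) * \<tau> \<omega>\<rfloor>)) \<omega>) = X n (\<tau> \<omega>) \<omega>"
    using AE_sde_path[OF assms(1)]
  proof eventually_elim
    case (elim \<omega>)
    then interpret sde_path b \<sigma> K "\<lambda>t. L t \<omega>" "\<lambda>t. X n t \<omega>" n .
    have nn: "0 \<le> \<tau> \<omega>" using hit_time_nonneg assms by (simp add: \<tau>_def)
    have "((\<lambda>t. X n (max 0 t) \<omega>) \<longlongrightarrow> X n (max 0 (\<tau> \<omega>)) \<omega>) (at_right (\<tau> \<omega>))"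
      using continuous_clamp[of "\<lambda>t. X n t \<omega>" "\<tau> \<omega>"] x_right by (simp add: continuous_within)
    from filterlim_compose[OF this filterlim_floor_at_right] nn show ?case
      by (intro limI) (simp add: max_absorb2)
  qed
  ultimately show ?thesis unfolding \<tau>_def by (rule measurable_completion_AE)
qed

text \<open>The level of \<open>L\<close>, on the scale \<open>n\<close>, at which \<open>X n\<close> passes \<open>b k\<close> when overshoots are
  neglected.\<close>

definition "driver_level k = (\<Sum>j<k. (b (Suc j) - b j) / \<sigma> (Suc j))"

lemma driver_level_pos:
  assumes "k < K"
  shows "0 < driver_level (Suc k)"
  unfolding driver_level_def using assms b_less \<sigma>_pos
  by (intro sum_pos divide_pos_pos) auto

text \<open>Good-path conditions are bundled with the three error bounds, under one constant, so
  that the deterministic lemmas apply directly; \<open>\<alpha> / \<beta>\<close> is the mean speed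
  of \<open>L\<close>. It is a predicate because it is only asserted off a measurable set of small
  probability.\<close>

definition hit_event :: "nat \<Rightarrow> nat \<Rightarrow> real \<Rightarrow> 'a \<Rightarrow> bool" where
  "hit_event k n C \<omega> \<longleftrightarrow>
     (let \<tau> = hit_time b (\<lambda>t. X n t \<omega>) k in
      sde_path b \<sigma> K (\<lambda>t. L t \<omega>) (\<lambda>t. X n t \<omega>) n \<and> L 0 \<omega> = 0 \<and>
      \<bar>\<tau> - real n * driver_level k / (\<alpha> / \<beta>)\<bar> \<le> C * sqrt (real n) \<and>
      \<bar>L \<tau> \<omega> - real n * driver_level k\<bar> \<le> C * sqrt (real n) \<and>
      real n * \<bar>X n \<tau> \<omega> - b k\<bar> \<le> C * sqrt (real n))"

lemma hit_event_mono: "hit_event k n C \<omega> \<Longrightarrow> C \<le> D \<Longrightarrow> hit_event k n D \<omega>"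
  unfolding hit_event_def Let_def by (meson order_trans mult_right_mono real_sqrt_ge_zero of_nat_0_le_iff)

text \<open>Boundedness in probability at the scale \<open>sqrt n\<close>. In the induction step
  half of \<open>\<epsilon>\<close> is spent on level \<open>k\<close> and a quarter on the
  fluctuation of \<open>L\<close> at each of the two enclosing times.\<close>

lemma hit_event_likely:
  assumes "k \<le> K" "\<epsilon> > 0"
  shows "\<exists>C\<ge>0. \<forall>\<^sub>F n in sequentially. \<exists>A\<in>sets M. prob A \<le> \<epsilon> \<and> (\<forall>\<omega>\<in>space M - A. hit_event k n C \<omega>)"
  using assms
proof (induction k arbitrary: \<epsilon>)
  case 0
  have "\<exists>A\<in>sets M. prob A \<le> \<epsilon> \<and> (\<forall>\<omega>\<in>space M - A. hit_event 0 n 0 \<omega>)" if "n \<ge> 1" for n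
  proof -
    have "AE \<omega> in M. hit_event 0 n 0 \<omega>"
      using AE_sde_path[OF that] AE_L(1)
    proof eventually_elim
      case (elim \<omega>)
      then show ?case
        using sde_path.x_0[OF elim(1)] by (simp add: hit_event_def hit_time_def driver_level_def b_0)
    qed
    then obtain N where "{\<omega> \<in> space M. \<not> hit_event 0 n 0 \<omega>} \<subseteq> N" "emeasure M N = 0" "N \<in> sets M"
      by (rule AE_E)
    then show ?thesis using \<open>\<epsilon> > 0\<close> by (intro bexI[of _ N]) (auto simp: emeasure_eq_measure)
  qed
  then show ?case by (intro exI[of _ 0]) (auto simp: eventually_at_top_linorder)
next
  case (Suc k)
  \<comment> \<open>For large \<open>n\<close> both enclosing times are at most
    \<open>n * T\<close>; the summand 1 leaves room for \<open>\<rho> * sqrt n\<close>.\<close>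
  define \<gamma> S c' T where "\<gamma> = \<alpha> / \<beta>" and "S = \<sigma> (Suc k)" and "c' = driver_level (Suc k)" and "T = c' / \<gamma> + 1"
  have k: "k < K" using Suc.prems by simp
  have \<gamma>: "\<gamma> > 0" using \<alpha> \<beta> by (simp add: \<gamma>_def)
  have S: "S > 0" using \<sigma>_pos k by (simp add: S_def)
  have c': "c' > 0" "c' = driver_level k + (b (Suc k) - b k) / \<sigma> (Suc k)"
    using driver_level_pos[OF k] by (simp_all add: c'_def driver_level_def)
  have T: "T > 0" using c' \<gamma> by (simp add: T_def add_pos_pos)
  obtain C where C: "C \<ge> 0" and IH: "\<forall>\<^sub>F n in sequentially. \<exists>A\<in>sets M. prob A \<le> \<epsilon> / 2 \<and>
      (\<forall>\<omega>\<in>space M - A. hit_event k n C \<omega>)"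
    using Suc.IH[of "\<epsilon> / 2"] Suc.prems by auto
  \<comment> \<open>Makes the Chebyshev bound at time \<open>n * T\<close> with deviation
    \<open>\<delta> * sqrt n\<close> equal to \<open>\<epsilon> / 4\<close>; \<open>n\<close>
    cancels.\<close>
  define \<delta> where "\<delta> = sqrt (4 * \<alpha> * T / (\<beta>\<^sup>2 * \<epsilon>))"
  have \<delta>: "\<delta> > 0" "\<delta>\<^sup>2 = 4 * \<alpha> * T / (\<beta>\<^sup>2 * \<epsilon>)"
    using \<alpha> \<beta> T Suc.prems by (simp_all add: \<delta>_def)
  \<comment> \<open>The summand 1 secures the strict inequality required by
    \<open>hit_time_step\<close>.\<close>
  define \<rho> where "\<rho> = (\<delta> + C + C / S + 1) / \<gamma>"
  have \<rho>: "\<rho> > 0" "\<gamma> * \<rho> = \<delta> + C + C / S + 1"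
    using \<gamma> \<delta> C S by (auto simp: \<rho>_def intro!: divide_pos_pos add_pos_nonneg add_nonneg_pos)
  define D where "D = \<rho> + (\<gamma> * \<rho> + \<delta>) + (C + S * (\<gamma> * \<rho> + \<delta> + C))"
  have nn: "0 \<le> \<gamma> * \<rho> + \<delta>" "0 \<le> C + S * (\<gamma> * \<rho> + \<delta> + C)"
    using \<gamma> \<rho>(1) \<delta>(1) C S by simp_all
  have D: "\<rho> \<le> D" "\<gamma> * \<rho> + \<delta> \<le> D" "C + S * (\<gamma> * \<rho> + \<delta> + C) \<le> D"
    using nn \<rho>(1) by (auto simp: D_def)
  have "\<forall>\<^sub>F n in sequentially. \<exists>A\<in>sets M. prob A \<le> \<epsilon> \<and> (\<forall>\<omega>\<in>space M - A. hit_event (Suc k) n D \<omega>)"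
    \<comment> \<open>For large \<open>n\<close>, \<open>\<rho> * sqrt n\<close> is below
      \<open>n\<close>, so that \<open>s2 \<le> n * T\<close>, and below
      \<open>n * c' / \<gamma>\<close>, so that \<open>s1 > 0\<close>.\<close>
    using IH eventually_sqrt_less[OF zero_less_one, of \<rho>]
      eventually_sqrt_less[OF divide_pos_pos[OF c'(1) \<gamma>], of \<rho>] eventually_gt_at_top[of 0]
  proof eventually_elim
    case (elim n)
    define r s1 s2 where "r = sqrt (real n)" and "s1 = real n * c' / \<gamma> - \<rho> * r" and "s2 = real n * c' / \<gamma> + \<rho> * r"
    have r: "r > 0" "r\<^sup>2 = real n" using elim by (simp_all add: r_def)
    have s: "0 < s1" "0 < s2" "s1 \<le> real n * T" "s2 \<le> real n * T"
    proof -
      have "0 < \<rho> * r" using \<rho> r by simp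
      moreover have "\<rho> * r < real n * c' / \<gamma>" "\<rho> * r < real n"
        using elim by (simp_all add: r_def mult.commute)
      moreover have "real n * T = real n * c' / \<gamma> + real n" by (simp add: T_def algebra_simps)
      ultimately show "0 < s1" "0 < s2" "s1 \<le> real n * T" "s2 \<le> real n * T"
        unfolding s1_def s2_def by linarith+
    qed
    define E where "E s = {\<omega> \<in> space M. \<bar>L s \<omega> - L 0 \<omega> - \<alpha> * s / \<beta>\<bar> > \<delta> * r}" for s
    have E_sets: "E s \<in> sets M" if "s > 0" for s
    proof -
      have [measurable]: "L s \<in> borel_measurable M" "L 0 \<in> borel_measurable M"
        using that by (auto intro: measurable_L)
      show ?thesis unfolding E_def by measurable
    qed
    have E_prob: "prob (E s) \<le> \<epsilon> / 4" if "s > 0" "s \<le> real n * T" for s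
    proof -
      have "prob (E s) \<le> \<alpha> * s / (\<beta>\<^sup>2 * (\<delta> * r)\<^sup>2)"
        unfolding E_def using that \<delta> r by (intro L_Chebyshev) auto
      also have "\<dots> \<le> \<alpha> * (real n * T) / (\<beta>\<^sup>2 * (\<delta> * r)\<^sup>2)"
        using that \<alpha> by (intro divide_right_mono mult_left_mono) auto
      also have "\<dots> = \<epsilon> / 4"
        unfolding power_mult_distrib \<delta> r(2) using \<alpha> \<beta> T Suc.prems elim by (simp add: field_simps)
      finally show ?thesis .
    qed
    from elim obtain A where A: "A \<in> sets M" "prob A \<le> \<epsilon> / 2" "\<And>\<omega>. \<omega> \<in> space M - A \<Longrightarrow> hit_event k n C \<omega>"
      by blast
    show ?case
    proof (intro bexI conjI ballI)
      show "A \<union> (E s1 \<union> E s2) \<in> sets M" using A E_sets s by auto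
      have "prob (A \<union> (E s1 \<union> E s2)) \<le> prob A + (prob (E s1) + prob (E s2))"
        using A E_sets s by (intro order_trans[OF measure_Un_le] add_left_mono measure_Un_le) auto
      also have "\<dots> \<le> \<epsilon>" using A(2) E_prob[of s1] E_prob[of s2] s by linarith
      finally show "prob (A \<union> (E s1 \<union> E s2)) \<le> \<epsilon>" .
      fix \<omega> assume \<omega>: "\<omega> \<in> space M - (A \<union> (E s1 \<union> E s2))"
      then have ev: "hit_event k n C \<omega>" using A by blast
      then interpret sde_path b \<sigma> K "\<lambda>t. L t \<omega>" "\<lambda>t. X n t \<omega>" n by (simp add: hit_event_def Let_def)
      have L0: "L 0 \<omega> = 0" using ev by (simp add: hit_event_def Let_def)
      have Ls: "\<bar>L s \<omega> - \<gamma> * s\<bar> \<le> \<delta> * r" if "s = s1 \<or> s = s2" for s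
        using \<omega> that L0 by (auto simp: E_def \<gamma>_def not_less)
      have step: "\<bar>\<tau> (Suc k) - real n * c' / \<gamma>\<bar> \<le> \<rho> * r"
        "\<bar>L (\<tau> (Suc k)) \<omega> - real n * c'\<bar> \<le> (\<gamma> * \<rho> + \<delta>) * r"
        "real n * \<bar>X n (\<tau> (Suc k)) \<omega> - b (Suc k)\<bar> \<le> (C + S * (\<gamma> * \<rho> + \<delta> + C)) * r"
        using hit_time_step[OF k c'(2) s1_def s2_def \<gamma> r(1) less_imp_le[OF \<rho>(1)] C less_imp_le[OF s(1)]
            _ _ Ls Ls] ev \<rho>(2)
        by (auto simp: hit_event_def Let_def r_def[symmetric] S_def[symmetric])
      have "\<rho> * r \<le> D * r" "(\<gamma> * \<rho> + \<delta>) * r \<le> D * r" "(C + S * (\<gamma> * \<rho> + \<delta> + C)) * r \<le> D * r"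
        using D r by (auto intro!: mult_right_mono)
      then show "hit_event (Suc k) n D \<omega>"
        using step D L0 sde_path_axioms
        by (auto simp: hit_event_def Let_def r_def[symmetric] c'_def[symmetric] \<gamma>_def[symmetric])
    qed
  qed
  moreover have "0 \<le> D" using nn \<rho>(1) by (simp add: D_def)
  ultimately show ?case by blast
qed

section \<open>Contraction of the posterior\<close>

lemma posterior_tail_eq:
  assumes path: "sde_path b \<sigma> K l x n" and "1 \<le> k" "k \<le> K"
    and prior: "\<And>k. 1 \<le> k \<Longrightarrow> k \<le> K \<Longrightarrow> pa k > 0 \<and> pb k > 0"
  shows "measure (posterior \<alpha> \<beta> pa pb b K n x) {\<xi> \<in> space (posterior \<alpha> \<beta> pa pb b K n x). \<bar>\<xi> k - c\<bar> > \<eta>} =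
    measure (inverse_gamma (\<alpha> * delta_time b x k + pa k) (real n * \<beta> * delta_path b x k + pb k)) {y. \<bar>y - c\<bar> > \<eta>}"
proof -
  interpret sde_path b \<sigma> K l x n by (rule path)
  \<comment> \<open>The marginal of a product is its factor once all factors are probability
    measures, so positive parameters are wanted for every bin and not just for bin
    \<open>k\<close>.\<close>
  have pos: "\<alpha> * delta_time b x j + pa j > 0" "real n * \<beta> * delta_path b x j + pb j > 0"
    if "1 \<le> j" "j \<le> K" for j
    using delta_time_nonneg[of "j - 1"] delta_path_nonneg[of "j - 1"] prior[OF that] that \<alpha> \<beta>
    by (auto intro!: add_nonneg_pos)
  show ?thesis
    unfolding posterior_def
    using measure_PiM_component[of "{1..K}" "\<lambda>k. inverse_gamma (\<alpha> * delta_time b x k + pa k)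
        (real n * \<beta> * delta_path b x k + pb k)" k "{y. \<bar>y - c\<bar> > \<eta>}"] pos assms(2,3)
    by (auto simp: prob_space_inverse_gamma) (simp add: inverse_gamma_def)
qed

text \<open>The tail agrees almost surely with an inverse gamma tail, a measurable function of
  hitting times and of the path at those times.\<close>

lemma measurable_posterior_tail:
  assumes "n \<ge> 1" "1 \<le> k" "k \<le> K"
    and prior: "\<And>k. 1 \<le> k \<Longrightarrow> k \<le> K \<Longrightarrow> pa k > 0 \<and> pb k > 0"
  shows "(\<lambda>\<omega>. let P = posterior \<alpha> \<beta> pa pb b K n (\<lambda>t. X n t \<omega>) in
      measure P {\<xi> \<in> space P. \<bar>\<xi> k - c\<bar> > \<eta>}) \<in> borel_measurable (completion M)"
proof (rule measurable_completion_AE)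
  have k: "k - 1 \<le> K" using assms by simp
  note [measurable] = measurable_hit_time[OF assms(1,3)] measurable_hit_time[OF assms(1) k]
    measurable_X_hit_time[OF assms(1,3)] measurable_X_hit_time[OF assms(1) k]
  show "(\<lambda>\<omega>. measure (inverse_gamma (\<alpha> * delta_time b (\<lambda>t. X n t \<omega>) k + pa k)
      (real n * \<beta> * delta_path b (\<lambda>t. X n t \<omega>) k + pb k)) {y. \<bar>y - c\<bar> > \<eta>}) \<in> borel_measurable (completion M)"
    unfolding delta_time_def delta_path_def
    by (rule measurable_measure_inverse_gamma) measurable
  show "AE \<omega> in M. measure (inverse_gamma (\<alpha> * delta_time b (\<lambda>t. X n t \<omega>) k + pa k)
      (real n * \<beta> * delta_path b (\<lambda>t. X n t \<omega>) k + pb k)) {y. \<bar>y - c\<bar> > \<eta>} =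
      (let P = posterior \<alpha> \<beta> pa pb b K n (\<lambda>t. X n t \<omega>) in measure P {\<xi> \<in> space P. \<bar>\<xi> k - c\<bar> > \<eta>})"
    using AE_sde_path[OF assms(1)]
  proof eventually_elim
    case (elim \<omega>)
    show ?case unfolding Let_def by (rule posterior_tail_eq[OF elim assms(2,3) prior, symmetric])
  qed
qed

text \<open>Differencing two levels doubles the error constant. The shape is \<open>n * p\<close>
  and the scale \<open>\<sigma> (Suc k) * n * p\<close> up to order \<open>sqrt n\<close>, so the
  leading terms cancel in the scale minus \<open>\<sigma> (Suc k)\<close> times the shape less 2.
  \<open>D1\<close> and \<open>D2\<close> collect the remainders.\<close>

lemma posterior_tail_le:
  assumes k: "k < K" and pa: "pa (Suc k) > 0" and pb: "pb (Suc k) > 0" and "C \<ge> 0" "m > 0" "n \<ge> 1"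
    and ev: "hit_event k n C \<omega>" "hit_event (Suc k) n C \<omega>"
  defines "p \<equiv> \<beta> * ((b (Suc k) - b k) / \<sigma> (Suc k))"
    and "D1 \<equiv> 2 * \<alpha> * C + pa (Suc k) + 2"
  defines "D2 \<equiv> 2 * \<beta> * C + pb (Suc k) + \<sigma> (Suc k) * D1"
  assumes large: "D1 * sqrt (real n) \<le> p / 2 * real n"
  shows "measure (inverse_gamma (\<alpha> * delta_time b (\<lambda>t. X n t \<omega>) (Suc k) + pa (Suc k))
      (real n * \<beta> * delta_path b (\<lambda>t. X n t \<omega>) (Suc k) + pb (Suc k)))
      {y. \<bar>y - \<sigma> (Suc k)\<bar> > m / sqrt (real n)} \<le> (4 * D2\<^sup>2 / p\<^sup>2 + 2 * (\<sigma> (Suc k))\<^sup>2 / p) / m\<^sup>2"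
proof -
  interpret sde_path b \<sigma> K "\<lambda>t. L t \<omega>" "\<lambda>t. X n t \<omega>" n using ev by (simp add: hit_event_def Let_def)
  define S d r where "S = \<sigma> (Suc k)" and "d = (b (Suc k) - b k) / S" and "r = sqrt (real n)"
  have S: "S > 0" using \<sigma>_pos k by (simp add: S_def)
  have d: "S * d = b (Suc k) - b k" "d > 0" using S b_less[OF k] by (simp_all add: d_def)
  have p: "p = \<beta> * d" by (simp add: p_def d_def S_def)
  with \<beta> d have p_pos: "p > 0" by simp
  have r: "r \<ge> 1" using \<open>n \<ge> 1\<close> by (simp add: r_def)
  let ?\<Delta>\<tau> = "delta_time b (\<lambda>t. X n t \<omega>) (Suc k)" and ?\<Delta>x = "delta_path b (\<lambda>t. X n t \<omega>) (Suc k)"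
  have "driver_level (Suc k) = driver_level k + d" by (simp add: driver_level_def d_def S_def)
  then have "real n * driver_level (Suc k) / (\<alpha> / \<beta>) = real n * driver_level k / (\<alpha> / \<beta>) + real n * d / (\<alpha> / \<beta>)"
    by (simp add: algebra_simps add_divide_distrib)
  then have "\<bar>?\<Delta>\<tau> - real n * d / (\<alpha> / \<beta>)\<bar> \<le> 2 * (C * r)"
    using ev by (auto simp: hit_event_def Let_def delta_time_def r_def)
  then have "\<alpha> * \<bar>?\<Delta>\<tau> - real n * d / (\<alpha> / \<beta>)\<bar> \<le> \<alpha> * (2 * (C * r))"
    using \<alpha> by (intro mult_left_mono) auto
  also have "\<alpha> * \<bar>?\<Delta>\<tau> - real n * d / (\<alpha> / \<beta>)\<bar> = \<bar>\<alpha> * (?\<Delta>\<tau> - real n * d / (\<alpha> / \<beta>))\<bar>"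
    using \<alpha> by (simp add: abs_mult)
  also have "\<alpha> * (?\<Delta>\<tau> - real n * d / (\<alpha> / \<beta>)) = \<alpha> * ?\<Delta>\<tau> - real n * p"
    using \<alpha> \<beta> by (simp add: p field_simps)
  finally have \<tau>: "\<bar>\<alpha> * ?\<Delta>\<tau> - real n * p\<bar> \<le> 2 * \<alpha> * C * r" by (simp add: algebra_simps)
  have "real n * \<bar>?\<Delta>x - S * d\<bar> \<le> real n * (\<bar>X n (\<tau> (Suc k)) \<omega> - b (Suc k)\<bar> + \<bar>X n (\<tau> k) \<omega> - b k\<bar>)"
    by (intro mult_left_mono) (auto simp: d delta_path_def)
  also have "\<dots> \<le> 2 * (C * r)"
    using ev by (simp add: hit_event_def Let_def r_def distrib_left)
  finally have "\<beta> * (real n * \<bar>?\<Delta>x - S * d\<bar>) \<le> \<beta> * (2 * (C * r))"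
    using \<beta> by (intro mult_left_mono) auto
  also have "\<beta> * (real n * \<bar>?\<Delta>x - S * d\<bar>) = \<bar>\<beta> * real n * (?\<Delta>x - S * d)\<bar>"
    using \<beta> by (simp add: abs_mult)
  also have "\<beta> * real n * (?\<Delta>x - S * d) = real n * \<beta> * ?\<Delta>x - S * (real n * p)"
    by (simp add: p algebra_simps)
  finally have x: "\<bar>real n * \<beta> * ?\<Delta>x - S * (real n * p)\<bar> \<le> 2 * \<beta> * C * r" by (simp add: algebra_simps)
  \<comment> \<open>As \<open>r \<ge> 1\<close>, the prior parameters and the shift by 2 are
    absorbed into multiples of \<open>r\<close>.\<close>
  have pr: "pa (Suc k) + 2 \<le> (pa (Suc k) + 2) * r" "pb (Suc k) \<le> pb (Suc k) * r"
    using r pa pb by simp_all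
  have a: "\<bar>\<alpha> * ?\<Delta>\<tau> + pa (Suc k) - 2 - real n * p\<bar> \<le> D1 * r"
    using \<tau> pr pa unfolding D1_def by (simp add: distrib_right abs_le_iff)
  have c: "\<bar>real n * \<beta> * ?\<Delta>x + pb (Suc k) - S * (\<alpha> * ?\<Delta>\<tau> + pa (Suc k) - 2)\<bar> \<le> D2 * r"
  proof -
    have "\<bar>S * (\<alpha> * ?\<Delta>\<tau> + pa (Suc k) - 2 - real n * p)\<bar> \<le> S * (D1 * r)"
      unfolding abs_mult using a S by (intro mult_mono) auto
    then have "\<bar>S * (\<alpha> * ?\<Delta>\<tau> + pa (Suc k) - 2) - S * (real n * p)\<bar> \<le> S * D1 * r"
      by (simp add: right_diff_distrib mult.assoc)
    moreover have "D2 * r = 2 * \<beta> * C * r + pb (Suc k) * r + S * D1 * r"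
      by (simp add: D2_def S_def algebra_simps)
    ultimately show ?thesis using x pr(2) pb by linarith
  qed
  have "real n * \<beta> * ?\<Delta>x + pb (Suc k) > 0"
    using delta_path_nonneg[OF k] \<beta> pb by (intro add_nonneg_pos) auto
  then show ?thesis
    using a c large p_pos \<open>m > 0\<close> \<open>n \<ge> 1\<close>
    by (intro measure_inverse_gamma_tail_asymp[where U=D1]) (auto simp: S_def r_def)
qed

text \<open>For large \<open>n\<close>, off a set of probability at most
  \<open>2 * \<epsilon> / 3\<close>, the posterior tail is at most \<open>V / (m n)\<^sup>2\<close>
  with \<open>V\<close> independent of \<open>n\<close>, and this eventually drops to
  \<open>e\<close> or below.\<close>

lemma posterior_tail_tendsto:
  assumes "1 \<le> k" "k \<le> K"
    and prior: "\<And>k. 1 \<le> k \<Longrightarrow> k \<le> K \<Longrightarrow> pa k > 0 \<and> pb k > 0"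
    and m_pos: "\<And>n. n \<ge> 1 \<Longrightarrow> m n > 0" and m: "filterlim m at_top sequentially"
  shows "tendsto_in_prob (completion M)
      (\<lambda>n \<omega>. let P = posterior \<alpha> \<beta> pa pb b K n (\<lambda>t. X n t \<omega>)
              in measure P {\<xi> \<in> space P. \<bar>\<xi> k - \<sigma> k\<bar> > m n / sqrt (real n)}) 0"
proof -
  define Y where "Y n \<omega> = (let P = posterior \<alpha> \<beta> pa pb b K n (\<lambda>t. X n t \<omega>)
      in measure P {\<xi> \<in> space P. \<bar>\<xi> k - \<sigma> k\<bar> > m n / sqrt (real n)})" for n \<omega>
  have "\<forall>\<^sub>F n in sequentially. Y n \<in> borel_measurable (completion M)"
    using eventually_ge_at_top[of 1]
  proof eventually_elim
    case (elim n)
    then show ?case unfolding Y_def using assms(1,2) prior by (intro measurable_posterior_tail) auto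
  qed
  moreover have "(\<lambda>n. measure (completion M) {\<omega> \<in> space (completion M). \<bar>Y n \<omega> - 0\<bar> > e}) \<longlonglongrightarrow> 0"
    if e: "e > 0" for e
  proof (rule tendstoI)
    fix \<epsilon> :: real assume \<epsilon>: "\<epsilon> > 0"
    obtain j where j: "k = Suc j" "j < K" using assms(1,2) by (cases k) auto
    obtain C1 where C1: "C1 \<ge> 0" "\<forall>\<^sub>F n in sequentially. \<exists>A\<in>sets M. prob A \<le> \<epsilon> / 3 \<and>
        (\<forall>\<omega>\<in>space M - A. hit_event j n C1 \<omega>)"
      using hit_event_likely[of j "\<epsilon> / 3"] j \<epsilon> by auto
    obtain C2 where C2: "C2 \<ge> 0" "\<forall>\<^sub>F n in sequentially. \<exists>A\<in>sets M. prob A \<le> \<epsilon> / 3 \<and>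
        (\<forall>\<omega>\<in>space M - A. hit_event k n C2 \<omega>)"
      using hit_event_likely[of k "\<epsilon> / 3"] assms \<epsilon> by auto
    define C where "C = max C1 C2"
    define p where "p = \<beta> * ((b (Suc j) - b j) / \<sigma> (Suc j))"
    define D1 where "D1 = 2 * \<alpha> * C + pa (Suc j) + 2"
    define D2 where "D2 = 2 * \<beta> * C + pb (Suc j) + \<sigma> (Suc j) * D1"
    define V where "V = 4 * D2\<^sup>2 / p\<^sup>2 + 2 * (\<sigma> (Suc j))\<^sup>2 / p"
    have p: "p > 0" using \<beta> b_less \<sigma>_pos j by (simp add: p_def)
    then have V: "V \<ge> 0" by (simp add: V_def)
    have large: "\<forall>\<^sub>F n in sequentially. D1 * sqrt (real n) < p / 2 * real n"
      using p by (intro eventually_sqrt_less) simp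
    \<comment> \<open>This threshold gives both \<open>m n \<ge> 1\<close> and
      \<open>m n \<ge> V / e\<close>, hence \<open>(m n)\<^sup>2 \<ge> V / e\<close>.\<close>
    have m_large: "\<forall>\<^sub>F n in sequentially. V / e + 1 < m n"
      using m by (simp add: filterlim_at_top_dense)
    show "\<forall>\<^sub>F n in sequentially. dist (measure (completion M) {\<omega> \<in> space (completion M). \<bar>Y n \<omega> - 0\<bar> > e}) 0 < \<epsilon>"
      using C1(2) C2(2) large m_large eventually_ge_at_top[of 1]
    proof eventually_elim
      case (elim n)
      obtain A1 A2 where A: "A1 \<in> sets M" "prob A1 \<le> \<epsilon> / 3" "\<And>\<omega>. \<omega> \<in> space M - A1 \<Longrightarrow> hit_event j n C1 \<omega>"
        "A2 \<in> sets M" "prob A2 \<le> \<epsilon> / 3" "\<And>\<omega>. \<omega> \<in> space M - A2 \<Longrightarrow> hit_event k n C2 \<omega>"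
        using elim(1,2) by blast
      have V_e: "V / (m n)\<^sup>2 \<le> e"
      proof -
        have "V / e \<ge> 0" using V e by simp
        then have "V / e \<le> m n" "1 \<le> m n" using elim(4) by linarith+
        then have "V / e \<le> (m n)\<^sup>2" using mult_mono[of 1 "m n" "V / e" "m n"] V e
          by (simp add: power2_eq_square)
        then show ?thesis using e \<open>1 \<le> m n\<close> by (simp add: field_simps)
      qed
      have le: "\<bar>Y n \<omega>\<bar> \<le> e" if "\<omega> \<in> space M - (A1 \<union> A2)" for \<omega>
      proof -
        have ev: "hit_event j n C \<omega>" "hit_event (Suc j) n C \<omega>"
          using A(3)[of \<omega>] A(6)[of \<omega>] that j by (auto simp: C_def intro: hit_event_mono)
        then have path: "sde_path b \<sigma> K (\<lambda>t. L t \<omega>) (\<lambda>t. X n t \<omega>) n"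
          by (simp add: hit_event_def Let_def)
        have "Y n \<omega> = measure (inverse_gamma (\<alpha> * delta_time b (\<lambda>t. X n t \<omega>) (Suc j) + pa (Suc j))
            (real n * \<beta> * delta_path b (\<lambda>t. X n t \<omega>) (Suc j) + pb (Suc j)))
            {y. \<bar>y - \<sigma> (Suc j)\<bar> > m n / sqrt (real n)}"
          unfolding Y_def Let_def j(1) by (rule posterior_tail_eq[OF path]) (use j prior in auto)
        also have "\<dots> \<le> V / (m n)\<^sup>2"
          unfolding V_def D2_def D1_def p_def
          by (rule posterior_tail_le[OF j(2)])
             (use prior[of k] assms(1,2) j C1 C2 m_pos[of n] elim ev in \<open>auto simp: C_def D1_def p_def\<close>)
        finally have "Y n \<omega> \<le> e" using V_e by simp
        then show ?thesis by (simp add: Y_def Let_def)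
      qed
      \<comment> \<open>The event is covered by a set measurable in \<open>M\<close> itself, to
        which the completion assigns the same probability.\<close>
      have sub: "{\<omega> \<in> space (completion M). \<bar>Y n \<omega> - 0\<bar> > e} \<subseteq> A1 \<union> A2"
        using le by force
      interpret completion_M: prob_space "completion M" by (rule prob_space_completion)
      have "measure (completion M) {\<omega> \<in> space (completion M). \<bar>Y n \<omega> - 0\<bar> > e} \<le> measure (completion M) (A1 \<union> A2)"
        using sub A by (intro completion_M.finite_measure_mono) auto
      also have "\<dots> = prob (A1 \<union> A2)" using A by (intro measure_completion) auto
      also have "\<dots> \<le> prob A1 + prob A2" using A by (intro measure_Un_le)
      also have "\<dots> < \<epsilon>" using A \<epsilon> by linarith
      finally show ?case by simp
    qed
  qed
  ultimately show ?thesis unfolding tendsto_in_prob_def Y_def[symmetric] by blast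
qed

end

theorem theorem11:
  fixes M :: "'a measure"
    and L :: "real \<Rightarrow> 'a \<Rightarrow> real"
    and X :: "nat \<Rightarrow> real \<Rightarrow> 'a \<Rightarrow> real"
    and \<alpha> \<beta> :: real
    and K :: nat
    and b \<sigma> pa pb m :: "nat \<Rightarrow> real"
  assumes "prob_space M"
    and "\<alpha> > 0" and "\<beta> > 0"
    and "gamma_process M \<alpha> \<beta> L"
    and "K \<ge> 1"
    and "b 0 = 0" and "\<forall>k<K. b k < b (Suc k)"
    and "\<forall>k\<in>{1..K}. \<sigma> k > 0"
    and "\<forall>k\<in>{1..K}. pa k > 0 \<and> pb k > 0"
    and "\<forall>n\<ge>1. sde_solution M L b K \<sigma> n (X n)"
    and "\<forall>n\<ge>1. m n > 0" and "filterlim m at_top sequentially"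
  shows "\<forall>k\<in>{1..K}.
    tendsto_in_prob (completion M)
      (\<lambda>n \<omega>. let P = posterior \<alpha> \<beta> pa pb b K n (\<lambda>t. X n t \<omega>)
              in measure P {\<xi> \<in> space P. \<bar>\<xi> k - \<sigma> k\<bar> > m n / sqrt (real n)})
      0"
proof -
  interpret prob_space M by (rule assms)
  interpret volatility_model M b \<sigma> K L X \<alpha> \<beta>
    by unfold_locales (use assms in auto)
  show ?thesis
    using assms by (intro ballI posterior_tail_tendsto) auto
qed

end
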